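(* Let $S$ be the $(3,12)$-spectrum, let $A=\{126,162,168,180,182,192\}\cup\{n : n\text{ even},\ n\ge 204\}$, and let $U$ be the set of even integers belonging to one of the ranges $128$ to $160$, $164$ to $166$, $170$ to $178$, $184$ to $190$, $194$ to $202$ (endpoints included). Then $A\subseteq S\subseteq A\cup U$. In particular $N(3,12)\le 204$.
   Context: Graphs are finite and simple. For integers $k\ge 3$, $g\ge 3$, a $(k,g)$-graph is a $k$-regular graph of girth exactly $g$. The $(k,g)$-spectrum is the set of all integers $n$ such that there exists a connected $(k,g)$-graph of order $n$. For odd $k$, $N(k,g)$ denotes the smallest element $N$ of the $(k,g)$-spectrum such that all even integers $n\ge N$ belong to the $(k,g)$-spectrum. *)

theory Defs
  imports "Graph_Theory.Graph_Theory" "HOL-Library.Extended_Nat"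
begin

text \<open>Finite simple graphs are rendered by the locale \<^locale>\<open>pair_graph\<close>: finite symmetric
  loop-free digraphs without parallel arcs, where the edge \<open>{u, v}\<close> is the pair of arcs
  \<open>(u, v)\<close>, \<open>(v, u)\<close>. Hence the degree of a vertex is its out-degree. Traversing
  one edge back and forth is a \<open>cycle\<close> of length 2 in the sense of the library;
  the cycles of the simple graph are exactly those of length at least 3.\<close>

definition girth :: "'a pair_pre_digraph \<Rightarrow> enat" where
  "girth G = (INF p \<in> {p. pre_digraph.cycle (with_proj G) p \<and> 3 \<le> length p}. enat (length p))"

definition regular :: "nat \<Rightarrow> 'a pair_pre_digraph \<Rightarrow> bool" where
  "regular k G \<longleftrightarrow> (\<forall>v \<in> pverts G. out_degree (with_proj G) v = k)"

definition kg_graph :: "nat \<Rightarrow> nat \<Rightarrow> 'a pair_pre_digraph \<Rightarrow> bool" where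
  "kg_graph k g G \<longleftrightarrow> pair_graph G \<and> regular k G \<and> girth G = enat g"

text \<open>Every finite graph is isomorphic to one whose vertices are natural numbers, so nothing is
  lost by fixing the vertex type.\<close>

definition kg_spectrum :: "nat \<Rightarrow> nat \<Rightarrow> nat set" where
  "kg_spectrum k g =
    {n. \<exists>G :: nat pair_pre_digraph.
          kg_graph k g G \<and> connected (with_proj G) \<and> card (pverts G) = n}"

text \<open>\<open>kg_N k g\<close> is intended for odd \<open>k\<close> only, and is unspecified if no
  number has the required property.\<close>

definition kg_N :: "nat \<Rightarrow> nat \<Rightarrow> nat" where
  "kg_N k g = (LEAST N. N \<in> kg_spectrum k g \<and> (\<forall>n \<ge> N. even n \<longrightarrow> n \<in> kg_spectrum k g))"

end

theory Submission
  imports Defs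
begin

text \<open>
  The inclusion of the spectrum in \<open>A \<union> U\<close> says no more than that its members are even (handshake)
  and at least \<open>126\<close> (Moore bound: seen from an edge, a cubic graph of girth 12 contains two disjoint
  binary trees of depth 5, hence at least \<open>2 (1 + 2 + \<dots> + 2\<^sup>5)\<close> vertices).

  For the other inclusion, the spectrum is closed under addition (\<open>kg_spectrum_add\<close>): remove an edge
  \<open>uv\<close> from one graph and an edge \<open>xy\<close> from another and join \<open>u\<close> to \<open>x\<close> and \<open>v\<close> to \<open>y\<close>. A cycle that
  uses the two new edges contains a path from \<open>u\<close> to \<open>v\<close>, which the removed edge would close to a cycle of
  the first graph, so no short cycles arise. As \<open>126\<close> is in the spectrum, everything follows from the
  single orders \<open>162, 168, 180, 182, 192\<close> and the 63 even orders from \<open>204\<close> to \<open>328\<close>.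

  Seven of these orders are sums of smaller ones; for each other order a graph is exhibited. All of them are
  bipartite and Hamiltonian, and are given in LCF notation: the vertices are numbered along a
  Hamiltonian cycle, and a list, repeated periodically, gives for every vertex the difference
  to the other end of its chord. Most of these lists have a short period, that is, the graph is
  highly symmetric; for some orders of the form \<open>2 p\<close> and \<open>4 p\<close> with \<open>p\<close> prime the period is \<open>n\<close> or \<open>n/2\<close>.
  The girth is certified by counting: if the 48 walks of length 5 without backtracking that start
  in \<open>v\<close> have different ends, then \<open>v\<close> is on no cycle of length 4, 6, 8 or 10
  (\<open>cyc_ge_if_uniq_ends\<close>). In a bipartite graph it is enough to check this for the vertices on one side.
\<close>

section \<open>Graphs as symmetric relations\<close>

text \<open>The closing edge from the last to the first vertex is not repeated in the list.\<close>
definition cyc :: "'a rel \<Rightarrow> 'a list \<Rightarrow> bool" where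
  "cyc E xs \<longleftrightarrow> distinct xs \<and> 3 \<le> length xs \<and>
     successively (\<lambda>a b. (a, b) \<in> E) xs \<and> (last xs, hd xs) \<in> E"

locale kg_rel =
  fixes V :: "'a set" and E :: "'a rel" and k g :: nat
  assumes fin: "finite V" and ne: "V \<noteq> {}" and sub: "E \<subseteq> V \<times> V"
    and sym: "sym E" and irr: "irrefl E"
    and deg: "\<And>v. v \<in> V \<Longrightarrow> card (E `` {v}) = k"
    and conn: "\<And>u v. u \<in> V \<Longrightarrow> v \<in> V \<Longrightarrow> (u, v) \<in> E\<^sup>*"
    and ex_cyc: "\<exists>xs. cyc E xs \<and> length xs = g"
    and no_cyc: "\<And>xs. cyc E xs \<Longrightarrow> g \<le> length xs"

lemma successively_zip:
  "successively P (x # ys) \<and> P (last (x # ys)) z \<longleftrightarrow> (\<forall>(a, b) \<in> set (zip (x # ys) (ys @ [z])). P a b)"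
  by (induction ys arbitrary: x) auto

text \<open>The arcs of a cycle are the pairs of the list with its rotation; in this form, invariance
  under rotation, monotonicity and the passage to arc lists need no induction.\<close>
lemma cyc_zip:
  "cyc E xs \<longleftrightarrow> distinct xs \<and> 3 \<le> length xs \<and> set (zip xs (rotate1 xs)) \<subseteq> E"
proof (cases xs)
  case (Cons x ys)
  then show ?thesis
    using successively_zip[of "\<lambda>a b. (a, b) \<in> E" x ys x] by (auto simp: cyc_def)
qed (simp add: cyc_def)

lemma pcas_iff: "pcas u p v \<longleftrightarrow> map fst p @ [v] = u # map snd p"
  by (induction p arbitrary: u) auto

lemma pawalk_verts_pcas: "pcas u p v \<Longrightarrow> pawalk_verts u p = u # map snd p"
  by (induction p arbitrary: u) auto

lemma cycle_with_proj_iff: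
  assumes "E \<subseteq> V \<times> V"
  shows "pre_digraph.cycle (with_proj \<lparr>pverts = V, parcs = E\<rparr>) p \<and> 3 \<le> length p \<longleftrightarrow>
    cyc E (map fst p) \<and> map snd p = rotate1 (map fst p)"
proof -
  have *: "map fst p @ [u] = u # map snd p \<longleftrightarrow> u = fst (hd p) \<and> map snd p = rotate1 (map fst p)"
    if "p \<noteq> []" for u using that by (cases p) auto
  have "pre_digraph.cycle (with_proj \<lparr>pverts = V, parcs = E\<rparr>) p \<longleftrightarrow>
    p \<noteq> [] \<and> (\<exists>u. u \<in> V \<and> set p \<subseteq> E \<and> pcas u p u \<and> distinct (map snd p))"
    unfolding pre_digraph.cycle_def pre_digraph.awalk_def cas_with_proj_eq awalk_verts_with_proj_eq
    by (auto simp: pawalk_verts_pcas)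
  then have "pre_digraph.cycle (with_proj \<lparr>pverts = V, parcs = E\<rparr>) p \<longleftrightarrow>
    p \<noteq> [] \<and> fst (hd p) \<in> V \<and> set p \<subseteq> E \<and> map snd p = rotate1 (map fst p) \<and> distinct (map snd p)"
    unfolding pcas_iff using * by auto
  moreover have "fst (hd p) \<in> V" if "p \<noteq> []" "set p \<subseteq> E"
    using that assms by (cases p) auto
  moreover have "set (zip (map fst p) (rotate1 (map fst p))) = set p" if "map snd p = rotate1 (map fst p)"
    by (metis that zip_map_fst_snd)
  ultimately show ?thesis
    unfolding cyc_zip by (cases "p = []") (auto simp del: distinct_map)
qed

lemma girth_eq_iff:
  assumes "E \<subseteq> V \<times> V"
  shows "girth \<lparr>pverts = V, parcs = E\<rparr> = enat g \<longleftrightarrow>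
    (\<exists>xs. cyc E xs \<and> length xs = g) \<and> (\<forall>xs. cyc E xs \<longrightarrow> g \<le> length xs)"
proof -
  let ?L = "{n. \<exists>xs. cyc E xs \<and> length xs = n}"
  have "{p. pre_digraph.cycle (with_proj \<lparr>pverts = V, parcs = E\<rparr>) p \<and> 3 \<le> length p} =
    (\<lambda>xs. zip xs (rotate1 xs)) ` {xs. cyc E xs}"
    unfolding cycle_with_proj_iff[OF assms]
  proof (intro equalityI subsetI; clarsimp)
    fix p assume "cyc E (map fst p)" "map snd p = rotate1 (map fst p)"
    then show "p \<in> (\<lambda>xs. zip xs (rotate1 xs)) ` {xs. cyc E xs}"
      by (metis (mono_tags) imageI mem_Collect_eq zip_map_fst_snd)
  qed
  then have eq: "girth \<lparr>pverts = V, parcs = E\<rparr> = Inf (enat ` ?L)"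
    unfolding girth_def by (simp add: image_image) (rule arg_cong[where f = Inf], auto)
  show ?thesis
  proof
    assume l: "girth \<lparr>pverts = V, parcs = E\<rparr> = enat g"
    then obtain n where "n \<in> ?L" unfolding eq by (auto simp: Inf_enat_def split: if_splits)
    then have "Inf (enat ` ?L) \<in> enat ` ?L" by (intro wellorder_InfI) (rule imageI)
    then have "enat g \<in> enat ` ?L" using l unfolding eq by simp
    moreover have "enat g \<le> enat m" if "m \<in> ?L" for m
      using l Inf_lower[OF imageI[OF that, of enat]] unfolding eq by simp
    ultimately show "(\<exists>xs. cyc E xs \<and> length xs = g) \<and> (\<forall>xs. cyc E xs \<longrightarrow> g \<le> length xs)" by auto
  next
    assume "(\<exists>xs. cyc E xs \<and> length xs = g) \<and> (\<forall>xs. cyc E xs \<longrightarrow> g \<le> length xs)"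
    then show "girth \<lparr>pverts = V, parcs = E\<rparr> = enat g"
      unfolding eq by (intro antisym Inf_lower Inf_greatest) auto
  qed
qed

text \<open>This reduces the definition of the spectrum to relations and lists of vertices.\<close>
lemma kg_graph_connected_iff:
  "kg_graph k g \<lparr>pverts = V, parcs = E\<rparr> \<and> connected (with_proj \<lparr>pverts = V, parcs = E\<rparr>)
    \<longleftrightarrow> kg_rel V E k g"
proof -
  let ?G = "\<lparr>pverts = V, parcs = E\<rparr>"
  have 1: "pair_graph ?G \<longleftrightarrow> finite V \<and> E \<subseteq> V \<times> V \<and> sym E \<and> irrefl E"
    by (auto simp: pair_graph_def pair_digraph_def pair_pseudo_graph_def pair_fin_digraph_def
        pair_wf_digraph_def pair_fin_digraph_axioms_def pair_loopfree_digraph_def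
        pair_loopfree_digraph_axioms_def pair_sym_digraph_def pair_sym_digraph_axioms_def
        symmetric_def irrefl_def dest: finite_subset)
  have 2: "regular k ?G \<longleftrightarrow> (\<forall>v\<in>V. card (E `` {v}) = k)"
  proof -
    have "card (out_arcs (with_proj ?G) v) = card (E `` {v})" for v
      by (rule bij_betw_same_card[of snd]) (force simp: bij_betw_def inj_on_def out_arcs_def)
    then show ?thesis by (simp add: regular_def out_degree_def)
  qed
  have 3: "connected (with_proj ?G) \<longleftrightarrow> V \<noteq> {} \<and> (\<forall>u v. u \<in> V \<longrightarrow> v \<in> V \<longrightarrow> (u, v) \<in> E\<^sup>*)"
    if E: "E \<subseteq> V \<times> V" "sym E"
  proof -
    have "pair_wf_digraph ?G" using E by (auto simp: pair_wf_digraph_def)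
    moreover have "(u, v) \<in> rtrancl_on V E \<longleftrightarrow> (u, v) \<in> E\<^sup>*" if "u \<in> V" for u v
    proof
      show "(u, v) \<in> rtrancl_on V E" if "(u, v) \<in> E\<^sup>*"
        using that by (induction) (use \<open>u \<in> V\<close> E in \<open>auto intro: rtrancl_on_into_rtrancl_on\<close>)
    qed (auto dest: rtrancl_on_rtranclI)
    moreover have "parcs (mk_symmetric (with_proj ?G)) = E"
      using E by (auto simp: parcs_mk_symmetric sym_def)
    ultimately show ?thesis
      by (auto simp: connected_def strongly_connected_def reachable_def)
  qed
  show ?thesis
  proof (cases "E \<subseteq> V \<times> V \<and> sym E")
    case True
    then have E: "E \<subseteq> V \<times> V" "sym E" by auto
    show ?thesis
      unfolding kg_graph_def kg_rel_def 1 2 3[OF E] girth_eq_iff[OF E(1)] Ball_def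
      by (rule iffI; elim conjE; intro conjI) assumption+
  next
    case False
    have "\<not> pair_graph ?G" unfolding 1 using False by auto
    moreover have "\<not> kg_rel V E k g" using False kg_rel.sub[of V E k g] kg_rel.sym[of V E k g] by auto
    ultimately show ?thesis unfolding kg_graph_def by simp
  qed
qed

lemma kg_spectrum_iff:
  "n \<in> kg_spectrum k g \<longleftrightarrow> (\<exists>(V :: nat set) E. kg_rel V E k g \<and> card V = n)"
proof
  assume "n \<in> kg_spectrum k g"
  then obtain G :: "nat pair_pre_digraph"
    where G: "kg_graph k g G" "connected (with_proj G)" "card (pverts G) = n"
    unfolding kg_spectrum_def mem_Collect_eq by (elim exE conjE)
  obtain V E where VE: "G = \<lparr>pverts = V, parcs = E\<rparr>" by (cases G)
  then have "kg_rel V E k g" using G kg_graph_connected_iff[of k g V E] by simp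
  then show "\<exists>(V :: nat set) E. kg_rel V E k g \<and> card V = n" using G(3) unfolding VE pair_pre_digraph.simps by metis
next
  assume "\<exists>(V :: nat set) E. kg_rel V E k g \<and> card V = n"
  then obtain V :: "nat set" and E where VE: "kg_rel V E k g" "card V = n" by blast
  let ?G = "\<lparr>pverts = V, parcs = E\<rparr>"
  have "kg_graph k g ?G \<and> connected (with_proj ?G) \<and> card (pverts ?G) = n"
    using VE kg_graph_connected_iff[of k g V E] by simp
  then show "n \<in> kg_spectrum k g" unfolding kg_spectrum_def mem_Collect_eq by (rule exI)
qed

lemma cyc_subset:
  assumes "cyc E xs" "E \<subseteq> V \<times> V"
  shows "set xs \<subseteq> V"
proof -
  have "set xs = fst ` set (zip xs (rotate1 xs))"
    by (metis length_rotate1 list.set_map map_fst_zip)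
  then show ?thesis using assms unfolding cyc_zip by auto
qed

lemma cyc_map:
  assumes f: "inj_on f V" and E: "E \<subseteq> V \<times> V"
  shows "cyc (map_prod f f ` E) ys \<longleftrightarrow> (\<exists>xs. cyc E xs \<and> ys = map f xs)"
proof
  assume c: "cyc (map_prod f f ` E) ys"
  have "set ys \<subseteq> f ` V" using c E by (intro cyc_subset) auto
  then have "ys \<in> map f ` lists V" unfolding lists_image[symmetric] in_lists_conv_set by blast
  then obtain xs where xs: "set xs \<subseteq> V" "ys = map f xs" by auto
  have "cyc E xs"
  proof -
    have "set (zip xs (rotate1 xs)) \<subseteq> V \<times> V" using xs(1)
      by (auto elim!: in_set_zipE)
    moreover have "inj_on (map_prod f f) (V \<times> V)" using f by (auto simp: inj_on_def)
    moreover have "map_prod f f ` set (zip xs (rotate1 xs)) \<subseteq> map_prod f f ` E"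
      using c unfolding cyc_zip xs by (simp add: rotate1_map zip_map_map map_prod_def)
    ultimately have "set (zip xs (rotate1 xs)) \<subseteq> E"
      using E by (smt (verit) image_subset_iff imageE inj_onD subset_iff)
    then show ?thesis using c xs(2) unfolding cyc_zip by (simp add: distinct_map)
  qed
  then show "\<exists>xs. cyc E xs \<and> ys = map f xs" using xs by blast
next
  assume "\<exists>xs. cyc E xs \<and> ys = map f xs"
  then obtain xs where xs: "cyc E xs" "ys = map f xs" by blast
  have "set xs \<subseteq> V" using xs E cyc_subset by blast
  then have "inj_on f (set xs)" using f inj_on_subset by blast
  then show "cyc (map_prod f f ` E) ys" using xs
    unfolding cyc_zip by (simp add: distinct_map rotate1_map zip_map_map image_mono flip: map_prod_def)
qed

text \<open>The type of the vertices is free here, so sums of types and binary numerals can serve as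
  vertices below.\<close>
lemma kg_spectrumI:
  fixes V :: "'a set"
  assumes "kg_rel V E k g"
  shows "card V \<in> kg_spectrum k g"
proof -
  interpret kg_rel V E k g by fact
  obtain f :: "'a \<Rightarrow> nat" where f: "inj_on f V" using finite_imp_inj_to_nat_seg[OF fin] by auto
  let ?E = "map_prod f f ` E"
  have nb: "?E `` {f v} = f ` (E `` {v})" if "v \<in> V" for v
  proof -
    have "a = v" if "(a, b) \<in> E" "f a = f v" for a b
      using that \<open>v \<in> V\<close> f sub by (auto dest: inj_onD)
    then show ?thesis by (fastforce simp: Image_def image_iff)
  qed
  have "kg_rel (f ` V) ?E k g"
  proof
    show "card (?E `` {w}) = k" if "w \<in> f ` V" for w
    proof -
      obtain v where v: "v \<in> V" "w = f v" using \<open>w \<in> f ` V\<close> by blast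
      have "inj_on f (E `` {v})" using f sub by (auto intro: inj_on_subset)
      then show ?thesis using nb v deg by (simp add: card_image)
    qed
    show "irrefl ?E" using irr f sub by (auto simp: irrefl_def inj_on_def)
    show "sym ?E" using sym by (auto simp: sym_def)
    show "(u, v) \<in> ?E\<^sup>*" if uv: "u \<in> f ` V" "v \<in> f ` V" for u v
    proof -
      have "(f a, f b) \<in> ?E\<^sup>*" if "(a, b) \<in> E\<^sup>*" for a b
        using that by induction (auto intro: rtrancl_into_rtrancl)
      then show ?thesis using conn uv by blast
    qed
    show "\<exists>xs. cyc ?E xs \<and> length xs = g" using ex_cyc cyc_map[OF f sub] by force
    show "g \<le> length xs" if "cyc ?E xs" for xs using that no_cyc cyc_map[OF f sub] by force
  qed (use fin ne sub in auto)
  moreover have "card (f ` V) = card V" using f by (rule card_image)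
  ultimately show ?thesis unfolding kg_spectrum_iff by blast
qed

section \<open>The spectrum is closed under addition\<close>

lemma cyc_rotate1: "cyc E (rotate1 xs) \<longleftrightarrow> cyc E xs"
proof -
  have "zip (rotate1 as) (rotate1 bs) = rotate1 (zip as bs)" if "length as = length bs" for as bs :: "'a list"
    using that by (cases as; cases bs) auto
  then have "set (zip (rotate1 xs) (rotate1 (rotate1 xs))) = set (zip xs (rotate1 xs))" by simp
  then show ?thesis unfolding cyc_zip by simp
qed

lemma cyc_append_commute: "cyc E (xs @ ys) \<longleftrightarrow> cyc E (ys @ xs)"
proof (induction xs arbitrary: ys)
  case (Cons x xs)
  then show ?case using cyc_rotate1[of E "x # xs @ ys"] by simp
qed simp

lemma cyc_mono: "cyc E xs \<Longrightarrow> E \<subseteq> F \<Longrightarrow> cyc F xs"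
  unfolding cyc_zip by blast

lemma cyc_nth:
  "cyc E xs \<longleftrightarrow> distinct xs \<and> 3 \<le> length xs \<and>
    (\<forall>i. Suc i < length xs \<longrightarrow> (xs ! i, xs ! Suc i) \<in> E) \<and> (xs ! (length xs - 1), xs ! 0) \<in> E"
  unfolding cyc_def by (cases "xs = []") (auto simp: successively_conv_nth last_conv_nth hd_conv_nth)

text \<open>As \<open>3 \<le> k\<close>, a vertex of a shortest cycle has a neighbour besides its two neighbours on the
  cycle. Removing the edge to it does not destroy the cycle.\<close>
lemma (in kg_rel) edge_off_cyc:
  assumes "3 \<le> k"
  obtains u v xs where "(u, v) \<in> E" "cyc (E - {(u, v), (v, u)}) xs" "length xs = g"
proof -
  obtain xs where xs: "cyc E xs" "length xs = g" using ex_cyc by blast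
  note c = xs(1)[unfolded cyc_nth]
  let ?u = "xs ! 0" and ?l = "xs ! (length xs - 1)"
  have "?u \<in> V" using c sub by blast
  then have "card (E `` {?u}) \<ge> 3" using deg assms by simp
  have "\<not> E `` {?u} \<subseteq> {xs ! 1, ?l}"
  proof
    assume "E `` {?u} \<subseteq> {xs ! 1, ?l}"
    then have "card (E `` {?u}) \<le> card {xs ! 1, ?l}" by (intro card_mono) auto
    also have "\<dots> \<le> 2" by (simp add: card_insert_if)
    finally show False using \<open>card (E `` {?u}) \<ge> 3\<close> by simp
  qed
  then obtain w where w: "(?u, w) \<in> E" "w \<noteq> xs ! 1" "w \<noteq> ?l" by auto
  have eq: "xs ! i = xs ! j \<longleftrightarrow> i = j" if "i < length xs" "j < length xs" for i j
    using c that nth_eq_iff_index_eq by blast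
  have "cyc (E - {(?u, w), (w, ?u)}) xs"
    unfolding cyc_nth
  proof (intro conjI allI impI)
    show "(xs ! i, xs ! Suc i) \<in> E - {(?u, w), (w, ?u)}" if i: "Suc i < length xs" for i
    proof -
      have "xs ! i = ?u \<longleftrightarrow> i = 0" "xs ! Suc i \<noteq> ?u" using eq[of i 0] eq[of "Suc i" 0] i by linarith+
      then show ?thesis using c i w by auto
    qed
    show "(?l, ?u) \<in> E - {(?u, w), (w, ?u)}"
      using c w eq[of "length xs - 1" 0] by auto
  qed (use c in auto)
  then show thesis using that w(1) xs(2) by blast
qed

lemma successively_rtrancl:
  "successively (\<lambda>a b. (a, b) \<in> R) xs \<Longrightarrow> xs \<noteq> [] \<Longrightarrow> (hd xs, last xs) \<in> R\<^sup>*"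
  by (induction xs rule: induct_list012) (auto intro: converse_rtrancl_into_rtrancl)

text \<open>An edge on a cycle is not a bridge: the rest of the cycle is a detour.\<close>
lemma (in kg_rel) edge_on_cyc:
  obtains x y where "(x, y) \<in> E"
    "\<And>a b. a \<in> V \<Longrightarrow> b \<in> V \<Longrightarrow> (a, b) \<in> (E - {(x, y), (y, x)})\<^sup>*"
proof -
  obtain xs where xs: "cyc E xs" "length xs = g" using ex_cyc by blast
  note c = xs(1)[unfolded cyc_nth]
  let ?x = "xs ! (length xs - 1)" and ?y = "xs ! 0"
  let ?E = "E - {(?x, ?y), (?y, ?x)}"
  have eq: "xs ! i = xs ! j \<longleftrightarrow> i = j" if "i < length xs" "j < length xs" for i j
    using c that nth_eq_iff_index_eq by blast
  have "successively (\<lambda>a b. (a, b) \<in> ?E) xs"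
    unfolding successively_conv_nth
  proof (intro allI impI)
    fix i assume i: "Suc i < length xs"
    have len: "length xs \<ge> 3" and E: "(xs ! i, xs ! Suc i) \<in> E" using c i by blast+
    have "xs ! i \<noteq> ?x" "xs ! i = ?y \<longleftrightarrow> i = 0" "xs ! Suc i = ?x \<longleftrightarrow> Suc i = length xs - 1"
      using eq[of i "length xs - 1"] eq[of i 0] eq[of "Suc i" "length xs - 1"] i by linarith+
    moreover have "i \<noteq> 0 \<or> Suc i \<noteq> length xs - 1" using len by linarith
    ultimately show "(xs ! i, xs ! Suc i) \<in> ?E"
      using E unfolding Diff_iff insert_iff prod.inject by blast
  qed
  moreover have "xs \<noteq> []" using c by auto
  ultimately have yx: "(?y, ?x) \<in> ?E\<^sup>*"
    using successively_rtrancl[of ?E xs] by (simp add: hd_conv_nth last_conv_nth)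
  have "sym ?E" using sym by (auto simp: sym_def)
  then have xy: "(?x, ?y) \<in> ?E\<^sup>*" using yx by (metis sym_rtrancl symD)
  have "E \<subseteq> ?E\<^sup>*" using xy yx by blast
  then have "E\<^sup>* \<subseteq> ?E\<^sup>*" by (metis rtrancl_mono rtrancl_idemp)
  then show thesis using that[of ?x ?y] c conn by blast
qed

lemma card_exchange:
  assumes "finite A" "a \<in> A" "b \<notin> f ` A" "inj_on f A"
  shows "card (insert b (f ` (A - {a}))) = card A"
proof -
  have "card (f ` (A - {a})) = card A - 1"
    using assms by (subst card_image) (auto intro: inj_on_subset)
  moreover have "card A > 0" using assms by (auto simp: card_gt_0_iff)
  ultimately show ?thesis using assms by (subst card_insert_disjoint) auto
qed

text \<open>A cyclic sequence with entries of both kinds can be cut so that it begins with a maximal block of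
  left entries.\<close>
lemma mixed_rotation:
  assumes "Inl a \<in> set xs" "Inr b \<in> set xs"
  obtains ys zs where "cyc E xs \<longleftrightarrow> cyc E (map Inl ys @ zs)" "length xs = length ys + length zs"
    "ys \<noteq> []" "zs \<noteq> []" "\<not> isl (hd zs)" "\<not> isl (last zs)"
proof -
  obtain p q where pq: "xs = p @ Inl a # q" using assms(1) by (meson split_list)
  have "\<exists>x \<in> set (Inl a # q @ p). \<not> isl x"
    using assms(2) pq by (intro bexI[of _ "Inr b"]) auto
  then obtain p' r s where r: "Inl a # q @ p = p' @ r # s" "\<not> isl r" "\<forall>x \<in> set s. isl x"
    using split_list_last_prop[of "Inl a # q @ p" "\<lambda>x. \<not> isl x"] by auto
  let ?w = "s @ p' @ [r]"
  have "p' \<noteq> []" using r by (cases p') auto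
  then have "isl (hd p')" using r(1) by (cases p') auto
  let ?ys = "takeWhile isl ?w" and ?zs = "dropWhile isl ?w"
  have "isl (hd ?w)" using r(3) \<open>p' \<noteq> []\<close> \<open>isl (hd p')\<close> by (cases s) auto
  then have ys: "?ys \<noteq> []" using \<open>p' \<noteq> []\<close> by (cases s; cases p') auto
  have zs: "?zs \<noteq> []" using r(2) by (auto simp: dropWhile_eq_Nil_conv)
  have "?ys = map Inl (map projl ?ys)"
    unfolding map_map by (rule map_idI[symmetric]) (auto dest: set_takeWhileD)
  moreover have w: "?w = ?ys @ ?zs" by simp
  moreover have "cyc E xs \<longleftrightarrow> cyc E ?w"
    using cyc_append_commute[of E p "Inl a # q"] cyc_append_commute[of E s "p' @ [r]"]
      cyc_append_commute[of E "p' @ [r]" s] r(1) pq by simp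
  moreover have "last ?zs = r" using w zs by (metis last_appendR last_snoc append_assoc)
  moreover have "length xs = length ?w"
    using arg_cong[OF r(1), of length] pq by simp
  ultimately show thesis
    using that[of "map projl ?ys" ?zs] ys zs r(2) hd_dropWhile[of isl ?w]
    by (metis length_append length_map map_is_Nil_conv)
qed

lemma length_eq_1_if_hd_eq_last:
  assumes "distinct xs" "xs \<noteq> []" "hd xs = last xs"
  shows "length xs = 1"
proof (cases xs)
  case (Cons x ys)
  then have "ys = []" using assms last_in_set[of ys] by (cases "ys = []") simp_all
  then show ?thesis using Cons by simp
qed (use assms in simp)

text \<open>The edge \<open>uv\<close> is chosen off a shortest cycle, so that the girth does not increase, and
  \<open>xy\<close> is chosen on a cycle, so that the second graph stays connected and also links \<open>u\<close> and \<open>v\<close>, should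
  \<open>uv\<close> be a bridge.\<close>
theorem kg_spectrum_add:
  assumes "m \<in> kg_spectrum k g" "n \<in> kg_spectrum k g" "3 \<le> k"
  shows "m + n \<in> kg_spectrum k g"
proof -
  obtain V :: "nat set" and E where V: "kg_rel V E k g" "card V = m"
    using assms(1) kg_spectrum_iff by blast
  obtain W :: "nat set" and F where W: "kg_rel W F k g" "card W = n"
    using assms(2) kg_spectrum_iff by blast
  interpret G: kg_rel V E k g by fact
  interpret H: kg_rel W F k g by fact
  obtain u v xs where uv: "(u, v) \<in> E" "cyc (E - {(u, v), (v, u)}) xs" "length xs = g"
    using G.edge_off_cyc assms(3) by blast
  obtain x y where xy: "(x, y) \<in> F"
    "\<And>a b. a \<in> W \<Longrightarrow> b \<in> W \<Longrightarrow> (a, b) \<in> (F - {(x, y), (y, x)})\<^sup>*"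
    using H.edge_on_cyc by blast
  define E' where "E' = E - {(u, v), (v, u)}"
  define F' where "F' = F - {(x, y), (y, x)}"
  define C :: "(nat + nat) rel" where "C = {(Inl u, Inr x), (Inl v, Inr y)}"
  define J where "J = map_prod Inl Inl ` E' \<union> map_prod Inr Inr ` F' \<union> C \<union> C\<inverse>"
  have vs: "u \<in> V" "v \<in> V" "x \<in> W" "y \<in> W" using uv xy G.sub H.sub by auto
  have "u \<noteq> v" "x \<noteq> y" using uv xy G.irr H.irr by (auto simp: irrefl_def)
  have rev: "(v, u) \<in> E" "(y, x) \<in> F" using uv xy G.sym H.sym by (auto dest: symD)
  have JLL: "(Inl a, Inl b) \<in> J \<longleftrightarrow> (a, b) \<in> E'" for a b by (auto simp: J_def C_def)
  have JRR: "(Inr a, Inr b) \<in> J \<longleftrightarrow> (a, b) \<in> F'" for a b by (auto simp: J_def C_def)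
  have JLR: "(Inl a, Inr b) \<in> J \<longleftrightarrow> a = u \<and> b = x \<or> a = v \<and> b = y" for a b
    by (auto simp: J_def C_def)
  have JRL: "(Inr b, Inl a) \<in> J \<longleftrightarrow> a = u \<and> b = x \<or> a = v \<and> b = y" for a b
    by (auto simp: J_def C_def)
  have "kg_rel (V <+> W) J k g"
  proof
    show "finite (V <+> W)" using G.fin H.fin by simp
    show "V <+> W \<noteq> {}" using vs by auto
    show "J \<subseteq> (V <+> W) \<times> (V <+> W)"
      using G.sub H.sub vs by (auto simp: J_def C_def E'_def F'_def)
    show "sym J"
    proof (rule symI)
      have "sym E'" "sym F'" using G.sym H.sym by (auto simp: E'_def F'_def sym_def)
      then show "(q, p) \<in> J" if "(p, q) \<in> J" for p q
        using that by (cases p; cases q) (auto simp: JLL JRR JLR JRL dest: symD)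
    qed
    show "irrefl J"
      using G.irr H.irr by (auto simp: J_def C_def E'_def F'_def irrefl_def)
    show "card (J `` {w}) = k" if "w \<in> V <+> W" for w
    proof (cases w)
      case (Inl a)
      then have a: "a \<in> V" using that by auto
      have fin: "finite (E `` {a})" using G.sub G.fin by (auto intro: finite_subset)
      consider "a = u" | "a = v" | "a \<noteq> u" "a \<noteq> v" by blast
      then show ?thesis
      proof cases
        case 1
        then have "J `` {w} = insert (Inr x) (Inl ` (E `` {a} - {v}))"
          unfolding Inl using \<open>u \<noteq> v\<close> by (auto simp: J_def C_def E'_def image_iff)
        then show ?thesis using card_exchange[OF fin, of v "Inr x" Inl] 1 uv G.deg a by auto
      next
        case 2
        then have "J `` {w} = insert (Inr y) (Inl ` (E `` {a} - {u}))"
          unfolding Inl using \<open>u \<noteq> v\<close> by (auto simp: J_def C_def E'_def image_iff)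
        then show ?thesis using card_exchange[OF fin, of u "Inr y" Inl] 2 rev G.deg a by auto
      next
        case 3
        then have "J `` {w} = Inl ` (E `` {a})"
          unfolding Inl by (auto simp: J_def C_def E'_def image_iff)
        then show ?thesis using G.deg a by (simp add: card_image)
      qed
    next
      case (Inr a)
      then have a: "a \<in> W" using that by auto
      have fin: "finite (F `` {a})" using H.sub H.fin by (auto intro: finite_subset)
      consider "a = x" | "a = y" | "a \<noteq> x" "a \<noteq> y" by blast
      then show ?thesis
      proof cases
        case 1
        then have "J `` {w} = insert (Inl u) (Inr ` (F `` {a} - {y}))"
          unfolding Inr using \<open>x \<noteq> y\<close> by (auto simp: J_def C_def F'_def image_iff)
        then show ?thesis using card_exchange[OF fin, of y "Inl u" Inr] 1 xy H.deg a by auto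
      next
        case 2
        then have "J `` {w} = insert (Inl v) (Inr ` (F `` {a} - {x}))"
          unfolding Inr using \<open>x \<noteq> y\<close> by (auto simp: J_def C_def F'_def image_iff)
        then show ?thesis using card_exchange[OF fin, of x "Inl v" Inr] 2 rev H.deg a by auto
      next
        case 3
        then have "J `` {w} = Inr ` (F `` {a})"
          unfolding Inr by (auto simp: J_def C_def F'_def image_iff)
        then show ?thesis using H.deg a by (simp add: card_image)
      qed
    qed
    have RR: "(Inr a, Inr b) \<in> J\<^sup>*" if "a \<in> W" "b \<in> W" for a b
    proof -
      have "(Inr c, Inr d) \<in> J\<^sup>*" if "(c, d) \<in> F'\<^sup>*" for c d
        using that by induction (auto simp: JRR intro: rtrancl_into_rtrancl)
      then show ?thesis using xy(2) that unfolding F'_def by blast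
    qed
    have step: "(Inl a, Inl b) \<in> J\<^sup>*" if "(a, b) \<in> E" for a b
    proof -
      have "(Inl u, Inl v) \<in> J\<^sup>*"
        by (rule converse_rtrancl_into_rtrancl[OF _ rtrancl_into_rtrancl[OF RR[OF vs(3,4)]]])
          (simp_all add: JLR JRL)
      moreover have "(Inl v, Inl u) \<in> J\<^sup>*"
        by (rule converse_rtrancl_into_rtrancl[OF _ rtrancl_into_rtrancl[OF RR[OF vs(4,3)]]])
          (simp_all add: JLR JRL)
      ultimately show ?thesis using that JLL[of a b] by (auto simp: E'_def)
    qed
    have LL: "(Inl a, Inl b) \<in> J\<^sup>*" if "a \<in> V" "b \<in> V" for a b
    proof -
      have "(Inl c, Inl d) \<in> J\<^sup>*" if "(c, d) \<in> E\<^sup>*" for c d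
        using that by induction (auto intro: step rtrancl_trans)
      then show ?thesis using G.conn that by blast
    qed
    have LR: "(Inl u, Inr x) \<in> J\<^sup>*" "(Inr x, Inl u) \<in> J\<^sup>*" using JLR JRL by auto
    show "(p, q) \<in> J\<^sup>*" if "p \<in> V <+> W" "q \<in> V <+> W" for p q
    proof -
      have "(Inl a, Inr b) \<in> J\<^sup>*" "(Inr b, Inl a) \<in> J\<^sup>*" if "a \<in> V" "b \<in> W" for a b
        using rtrancl_trans[OF LL rtrancl_trans[OF LR(1) RR], of a b]
          rtrancl_trans[OF RR rtrancl_trans[OF LR(2) LL], of b a] that vs by auto
      then show ?thesis using that LL RR by (elim PlusE) auto
    qed
    show "\<exists>xs. cyc J xs \<and> length xs = g"
    proof (intro exI conjI)
      have "cyc (map_prod Inl Inl ` E') (map Inl xs)"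
        using cyc_map[of Inl UNIV E'] uv(2) by (auto simp: E'_def)
      then show "cyc J (map Inl xs)" by (rule cyc_mono) (auto simp: J_def)
    qed (use uv in simp)
    show "g \<le> length xs" if c: "cyc J xs" for xs
    proof -
      consider "\<forall>p\<in>set xs. isl p" | "\<forall>p\<in>set xs. \<not> isl p"
        | p q where "p \<in> set xs" "isl p" "q \<in> set xs" "\<not> isl q"
        by blast
      then show ?thesis
      proof cases
        case 1
        then have "map (Inl \<circ> projl) xs = xs" by (intro map_idI) simp
        then obtain ys where ys: "xs = map Inl ys" by (metis map_map)
        moreover have "ys \<noteq> []" using c ys by (auto simp: cyc_def)
        ultimately have "cyc E ys"
          using c unfolding cyc_nth by (auto simp: JLL distinct_map E'_def)
        then show ?thesis using G.no_cyc ys by simp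
      next
        case 2
        then have "map (Inr \<circ> projr) xs = xs" by (intro map_idI) simp
        then obtain ys where ys: "xs = map Inr ys" by (metis map_map)
        moreover have "ys \<noteq> []" using c ys by (auto simp: cyc_def)
        ultimately have "cyc F ys"
          using c unfolding cyc_nth by (auto simp: JRR distinct_map F'_def)
        then show ?thesis using H.no_cyc ys by simp
      next
        case 3
        \<comment> \<open>A maximal block of left entries is a path between \<open>u\<close> and \<open>v\<close>, or a single one of these vertices; the
          latter is impossible, since each of them has only one neighbour on the right.\<close>
        then have "Inl (projl p) \<in> set xs" "Inr (projr q) \<in> set xs" by simp_all
        then obtain ys zs where w: "cyc J xs \<longleftrightarrow> cyc J (map Inl ys @ zs)" "length xs = length ys + length zs"
          "ys \<noteq> []" "zs \<noteq> []" "\<not> isl (hd zs)" "\<not> isl (last zs)"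
          using mixed_rotation by metis
        obtain b c where bc: "hd zs = Inr b" "last zs = Inr c" using w(5,6)
          by (metis sum.collapse(2))
        have cy: "cyc J (map Inl ys @ zs)" using c w by blast
        then have *: "successively (\<lambda>a b. (a, b) \<in> J) (map Inl ys)" "(Inl (last ys), Inr b) \<in> J"
           "(Inr c, Inl (hd ys)) \<in> J" "distinct ys" "distinct zs" "3 \<le> length ys + length zs"
          using w(3,4) bc unfolding cyc_def
          by (auto simp: successively_append_iff last_map hd_map hd_append distinct_map)
        have E': "successively (\<lambda>a b. (a, b) \<in> E') ys"
          using *(1) by (simp add: successively_map JLL)
        show ?thesis
        proof (cases "last ys = hd ys")
          case True
          then have "length ys = 1" using \<open>distinct ys\<close> w(3) length_eq_1_if_hd_eq_last by metis
          moreover have "b = c" using *(2,3) True \<open>u \<noteq> v\<close> unfolding JLR JRL by auto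
          then have "length zs = 1"
            using \<open>distinct zs\<close> w(4) bc length_eq_1_if_hd_eq_last by metis
          ultimately show ?thesis using *(6) by simp
        next
          case False
          then have ends: "(last ys, hd ys) \<in> {(u, v), (v, u)}" using *(2,3) unfolding JLR JRL by auto
          have "3 \<le> length ys"
          proof (rule ccontr)
            assume "\<not> 3 \<le> length ys"
            then have "ys = [hd ys, last ys]" using False w(3)
              by (cases ys rule: remdups_adj.cases) (auto simp: not_le)
            then have "(hd ys, last ys) \<in> E'" using E' by (metis successively.simps(3))
            then show False using ends by (auto simp: E'_def)
          qed
          moreover have "successively (\<lambda>a b. (a, b) \<in> E) ys"
            using E' by (rule successively_mono) (auto simp: E'_def)
          ultimately have "cyc E ys" using ends uv rev \<open>distinct ys\<close> unfolding cyc_def by auto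
          then show ?thesis using G.no_cyc w(2) by fastforce
        qed
      qed
    qed
  qed
  then have "card (V <+> W) \<in> kg_spectrum k g" by (rule kg_spectrumI)
  then show ?thesis using V W G.fin H.fin by (simp add: card_Plus)
qed

section \<open>Walks without backtracking and the Moore bound\<close>

lemma (in kg_rel) card_arcs: "card E = k * card V"
proof -
  have "E = (SIGMA v : V. E `` {v})" using sub by auto
  then have "card E = (\<Sum>v\<in>V. card (E `` {v}))"
    using fin sub by (subst card_SigmaI[symmetric]) (auto intro: finite_subset)
  then show ?thesis using deg by simp
qed

lemma even_card_sym_irrefl:
  fixes E :: "'a :: linorder rel"
  assumes "finite E" "sym E" "irrefl E"
  shows "even (card E)"
proof -
  let ?U = "{(a, b) \<in> E. a < b}"
  have "E = ?U \<union> ?U\<inverse>"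
    using assms(2,3) by (auto simp: irrefl_def sym_def) (metis neqE)
  then have "card E = card (?U \<union> ?U\<inverse>)" by (rule arg_cong)
  moreover have "?U \<inter> ?U\<inverse> = {}" by auto
  moreover have "finite ?U" using assms(1) by (rule finite_subset[rotated]) auto
  ultimately have "card E = card ?U + card (?U\<inverse>)"
    using card_Un_disjoint[of ?U "?U\<inverse>"] by simp
  then show ?thesis by simp
qed

text \<open>Walks without backtracking, as lists of vertices.\<close>
fun nbw :: "'a rel \<Rightarrow> 'a list \<Rightarrow> bool" where
  "nbw E [] \<longleftrightarrow> False"
| "nbw E [x] \<longleftrightarrow> True"
| "nbw E [x, y] \<longleftrightarrow> (x, y) \<in> E"
| "nbw E (x # y # z # xs) \<longleftrightarrow> (x, y) \<in> E \<and> x \<noteq> z \<and> nbw E (y # z # xs)"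

lemma nbw_Cons: "nbw E (x # y # xs) \<longleftrightarrow>
    (x, y) \<in> E \<and> nbw E (y # xs) \<and> (xs \<noteq> [] \<longrightarrow> hd xs \<noteq> x)"
  by (cases xs) auto

lemma nbw_tl: "nbw E (x # xs) \<Longrightarrow> xs \<noteq> [] \<Longrightarrow> nbw E xs"
  by (cases xs) (auto simp: nbw_Cons)

lemma nbw_successively: "nbw E xs \<Longrightarrow> successively (\<lambda>a b. (a, b) \<in> E) xs"
  by (induction E xs rule: nbw.induct) auto

text \<open>Two walks that leave \<open>v\<close> in different directions combine to one walk through \<open>v\<close>.\<close>
lemma nbw_join:
  assumes "sym E" "nbw E (v # p)" "nbw E (v # q)" "p \<noteq> []" "q \<noteq> []" "hd p \<noteq> hd q"
  shows "nbw E (rev p @ v # q)"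
  using assms(2-)
proof (induction p arbitrary: v q)
  case (Cons b p)
  have bv: "nbw E (b # v # q)" using Cons.prems assms(1) by (auto simp: nbw_Cons dest: symD)
  show ?case
  proof (cases "p = []")
    case False
    then have "nbw E (rev p @ b # v # q)"
      using Cons.prems bv by (intro Cons.IH) (auto simp: nbw_Cons)
    then show ?thesis by simp
  qed (use bv in simp)
qed simp

text \<open>At the first repetition of a vertex, the walk would close a cycle shorter than the girth.\<close>
lemma nbw_distinct:
  assumes "irrefl E" "\<And>xs. cyc E xs \<Longrightarrow> g \<le> length xs" "nbw E w" "length w \<le> g"
  shows "distinct w"
  using assms(3,4)
proof (induction w)
  case (Cons x w)
  have d: "distinct w" using Cons by (cases "w = []") (auto dest: nbw_tl)
  have "x \<notin> set w"
  proof
    assume "x \<in> set w"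
    then obtain s r where w: "w = s @ x # r" "x \<notin> set s" by (meson split_list_first)
    have "nbw E (x # s @ x # r)" using Cons.prems w by simp
    then have "s \<noteq> []" "s \<noteq> [y]" for y using assms(1) by (auto simp: irrefl_def nbw_Cons)
    then have len: "length s \<ge> 2" by (cases s; cases "tl s") auto
    have suc: "successively (\<lambda>a b. (a, b) \<in> E) ((x # s) @ x # r)"
      using nbw_successively[OF \<open>nbw E (x # s @ x # r)\<close>] by simp
    have "cyc E (x # s)"
      using suc len d w unfolding cyc_def successively_append_iff by auto
    then have "g \<le> length (x # s)" by (rule assms(2))
    then show False using Cons.prems(2) w by simp
  qed
  then show ?case using d by simp
qed simp

text \<open>Where two such walks separate, they combine to a closed walk; it has a repeated vertex although
  it is too short for that.\<close>
lemma nbw_inj: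
  assumes "sym E" "irrefl E" "\<And>xs. cyc E xs \<Longrightarrow> g \<le> length xs"
    and "nbw E (v # p)" "nbw E (v # q)" "last (v # p) = last (v # q)" "length p + length q < g"
  shows "p = q"
  using assms(4-)
proof (induction p arbitrary: v q)
  case Nil
  then have "distinct (v # q)" using assms(2,3) by (intro nbw_distinct[of E g]) auto
  then show ?case using Nil by (metis distinct.simps(2) last.simps last_in_set)
next
  case (Cons b p)
  show ?case
  proof (cases q)
    case Nil
    then have "distinct (v # b # p)"
      using assms(2,3) Cons.prems by (intro nbw_distinct[of E g]) auto
    then show ?thesis using Cons.prems(3) Nil by (metis distinct.simps(2) last.simps last_in_set)
  next
    case q: (Cons c q')
    show ?thesis
    proof (cases "b = c")
      case True
      then have "p = q'" using Cons.prems q by (intro Cons.IH[of b q']) (auto simp: nbw_Cons)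
      then show ?thesis using True q by simp
    next
      case False
      then have "nbw E (rev (b # p) @ v # q)"
        using Cons.prems q assms(1) by (intro nbw_join) auto
      then have "distinct (rev (b # p) @ v # q)"
        by (rule nbw_distinct[of E g, rotated 2]) (use assms Cons.prems in auto)
      moreover have "last (b # p) \<in> set (b # p)" by (rule last_in_set) simp
      moreover have "last q \<in> set q" by (rule last_in_set) (simp add: q)
      ultimately show ?thesis using Cons.prems(3) q by (auto simp: disjoint_iff split: if_splits)
    qed
  qed
qed

definition nbws :: "'a rel \<Rightarrow> nat \<Rightarrow> 'a \<Rightarrow> 'a \<Rightarrow> 'a list set" where
  "nbws E l u v = {xs. nbw E (u # v # xs) \<and> length xs = l}"

lemma (in kg_rel) card_nbws:
  assumes "(u, v) \<in> E"
  shows "finite (nbws E l u v) \<and> card (nbws E l u v) = (k - 1) ^ l"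
  using assms
proof (induction l arbitrary: u v)
  case 0
  then have "nbws E 0 u v = {[]}" by (auto simp: nbws_def)
  then show ?case by simp
next
  case (Suc l)
  have step: "nbws E (Suc l) u v = (\<Union>w \<in> E `` {v} - {u}. (#) w ` nbws E l v w)"
    using Suc.prems by (auto simp: nbws_def length_Suc_conv image_iff nbw_Cons)
  have "v \<in> V" using Suc.prems sub by auto
  have finN: "finite (E `` {v})" using sub fin by (auto intro: finite_subset)
  have "u \<in> E `` {v}" using Suc.prems sym by (auto dest: symD)
  then have "card (E `` {v} - {u}) = k - 1" using deg[OF \<open>v \<in> V\<close>] by simp
  moreover have "card (\<Union>w \<in> E `` {v} - {u}. (#) w ` nbws E l v w)
      = (\<Sum>w \<in> E `` {v} - {u}. card ((#) w ` nbws E l v w))"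
    using finN Suc.IH by (intro card_UN_disjoint) auto
  moreover have "\<dots> = (\<Sum>w \<in> E `` {v} - {u}. (k - 1) ^ l)"
    using Suc.IH by (intro sum.cong) (auto simp: card_image)
  ultimately show ?case unfolding step using finN Suc.IH by auto
qed

text \<open>The two trees consist of the ends of the walks that leave the edge \<open>uv\<close> at \<open>v\<close> and at \<open>u\<close>. Both the
  vertices within one tree and the trees themselves are kept apart by \<open>nbw_inj\<close>: for two walks in the same tree
  the lengths add up to at most \<open>2 h - 2\<close>, for walks in different trees, the edge \<open>uv\<close> adds one.\<close>
theorem (in kg_rel) moore_bound:
  assumes g: "g = 2 * h" and "2 \<le> k"
  shows "2 * (\<Sum>l<h. (k - 1) ^ l) \<le> card V"
proof -
  obtain xs where "cyc E xs" using ex_cyc by blast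
  then obtain u v where uv: "(u, v) \<in> E" unfolding cyc_def by blast
  then have vu: "(v, u) \<in> E" using sym by (auto dest: symD)
  define T where "T a b = (\<lambda>xs. last (b # xs)) ` (\<Union>l<h. nbws E l a b)" for a b
  have card_T: "card (T a b) = (\<Sum>l<h. (k - 1) ^ l)" and sub_T: "T a b \<subseteq> V" if ab: "(a, b) \<in> E" for a b
  proof -
    have "inj_on (\<lambda>xs. last (b # xs)) (\<Union>l<h. nbws E l a b)"
      using g no_cyc by (auto intro!: inj_onI nbw_inj[OF sym irr, of g b] simp: nbws_def nbw_Cons)
    then have "card (T a b) = card (\<Union>l<h. nbws E l a b)" unfolding T_def by (rule card_image)
    also have "\<dots> = (\<Sum>l<h. card (nbws E l a b))"
      using card_nbws[OF ab] by (intro card_UN_disjoint) (auto simp: nbws_def)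
    finally show "card (T a b) = (\<Sum>l<h. (k - 1) ^ l)" using card_nbws[OF ab] by simp
    have "last (b # xs) \<in> V" if "nbw E (a # b # xs)" for xs
      using that sub by (induction xs arbitrary: a b) (auto simp: nbw_Cons)
    then show "T a b \<subseteq> V" unfolding T_def nbws_def by blast
  qed
  have "T u v \<inter> T v u = {}"
  proof (rule ccontr)
    assume "T u v \<inter> T v u \<noteq> {}"
    then obtain p q where p: "nbw E (u # v # p)" "length p < h"
      and q: "nbw E (v # u # q)" "length q < h" and eq: "last (v # p) = last (u # q)"
      unfolding T_def nbws_def by blast
    have "v # p = q"
      using p q eq g by (intro nbw_inj[OF sym irr no_cyc, of u]) (auto simp: nbw_Cons)
    then show False using q by auto
  qed
  then have "card (T u v \<union> T v u) = 2 * (\<Sum>l<h. (k - 1) ^ l)"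
    using card_T[OF uv] card_T[OF vu] finite_subset[OF sub_T fin] uv vu
    by (subst card_Un_disjoint) auto
  moreover have "card (T u v \<union> T v u) \<le> card V"
    using sub_T uv vu fin by (intro card_mono) auto
  ultimately show ?thesis by simp
qed

lemma spectrum_3_12_bounds:
  assumes "n \<in> kg_spectrum 3 12"
  shows "even n" "126 \<le> n"
proof -
  obtain V :: "nat set" and E where V: "kg_rel V E 3 12" "card V = n"
    using assms kg_spectrum_iff by blast
  interpret kg_rel V E 3 12 by fact
  have "finite E" using sub fin by (auto intro: finite_subset)
  then have "even (3 * card V)" using even_card_sym_irrefl sym irr card_arcs by metis
  then show "even n" using V by simp
  show "126 \<le> n" using moore_bound[of 6] V by (simp add: eval_nat_numeral)
qed

section \<open>A local criterion for the girth of bipartite graphs\<close>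

lemma nbw_if_distinct:
  "successively (\<lambda>a b. (a, b) \<in> E) xs \<Longrightarrow> distinct xs \<Longrightarrow> xs \<noteq> [] \<Longrightarrow> nbw E xs"
  by (induction E xs rule: nbw.induct) auto

lemma nbw_snoc: "nbw E (xs @ [a, b]) \<Longrightarrow> (b, c) \<in> E \<Longrightarrow> c \<noteq> a \<Longrightarrow> nbw E (xs @ [a, b, c])"
proof (induction xs)
  case (Cons x xs)
  then show ?case by (cases xs; cases "tl xs") (auto simp: nbw_Cons)
qed auto

definition uniq_ends :: "'a rel \<Rightarrow> nat \<Rightarrow> 'a \<Rightarrow> bool" where
  "uniq_ends E l v \<longleftrightarrow> (\<forall>p q. nbw E (v # p) \<and> nbw E (v # q) \<and> length p = l \<and> length q = l \<and>
     last (v # p) = last (v # q) \<longrightarrow> p = q)"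

text \<open>Two walks with a common end have a common prolongation, since a third neighbour of the end is free.
  Hence it is enough to examine walks of one length.\<close>
lemma uniq_ends_pred:
  assumes ext: "\<forall>u v a b. (u, v) \<in> E \<longrightarrow> (\<exists>c. (v, c) \<in> E \<and> c \<noteq> a \<and> c \<noteq> b)"
    and "uniq_ends E (Suc l) v"
  shows "uniq_ends E l v"
  unfolding uniq_ends_def
proof (intro allI impI, elim conjE)
  fix p q
  assume p: "nbw E (v # p)" "length p = l" and q: "nbw E (v # q)" "length q = l"
    and eq: "last (v # p) = last (v # q)"
  show "p = q"
  proof (cases "l = 0")
    case False
    have split: "\<exists>s a. v # r = s @ [a, last (v # r)] \<and> (a, last (v # r)) \<in> E"
      if "r \<noteq> []" "nbw E (v # r)" for r
    proof -
      have "v # r = butlast (v # butlast r) @ [last (v # butlast r), last r]"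
        using that(1) by (metis append_Cons append_assoc append_butlast_last_id append_eq_Cons_conv list.distinct(1))
      moreover from this have "(last (v # butlast r), last r) \<in> E"
        using nbw_successively[OF that(2)] by (metis successively.simps(3) successively_append_iff)
      ultimately show ?thesis using that(1) by (metis last_ConsR)
    qed
    obtain s a where s: "v # p = s @ [a, last (v # p)]" "(a, last (v # p)) \<in> E"
      using split[of p] p False by auto
    obtain t b where t: "v # q = t @ [b, last (v # p)]" "(b, last (v # p)) \<in> E"
      using split[of q] q False eq by auto
    obtain c where c: "(last (v # p), c) \<in> E" "c \<noteq> a" "c \<noteq> b" using ext s(2) by blast
    have "nbw E (s @ [a, last (v # p), c])" "nbw E (t @ [b, last (v # p), c])"
      using p(1) q(1) s t c by (auto intro!: nbw_snoc simp del: last.simps)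
    then have "nbw E (v # p @ [c])" "nbw E (v # q @ [c])" using s(1) t(1)
      by (metis append_Cons append_assoc append_Nil)+
    then have "p @ [c] = q @ [c]"
      using assms(2)[unfolded uniq_ends_def, rule_format, of "p @ [c]" "q @ [c]"] p(2) q(2) by simp
    then show ?thesis by simp
  qed (use p q in simp)
qed

lemma uniq_ends_antimono:
  assumes ext: "\<forall>u v a b. (u, v) \<in> E \<longrightarrow> (\<exists>c. (v, c) \<in> E \<and> c \<noteq> a \<and> c \<noteq> b)"
    and "uniq_ends E l v" "j \<le> l"
  shows "uniq_ends E j v"
  using assms(3,2)
proof (induction j rule: inc_induct)
  case (step j)
  then show ?case using uniq_ends_pred[OF ext] by blast
qed

text \<open>A cycle has even length \<open>2 j\<close>, and its two halves are different walks of length \<open>j\<close> with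
  the same ends. One may start at a vertex of either colour.\<close>
lemma cyc_ge_if_uniq_ends:
  assumes "sym E"
    and ext: "\<forall>u v a b. (u, v) \<in> E \<longrightarrow> (\<exists>c. (v, c) \<in> E \<and> c \<noteq> a \<and> c \<noteq> b)"
    and col: "\<And>x y. (x, y) \<in> E \<Longrightarrow> col x \<noteq> col y"
    and uniq: "\<And>x y. (x, y) \<in> E \<Longrightarrow> col x \<Longrightarrow> uniq_ends E l x"
    and "cyc E xs"
  shows "2 * l + 2 \<le> length xs"
proof -
  have main: "2 * l + 2 \<le> length xs" if c: "cyc E xs" and "col (hd xs)" for xs
  proof (rule ccontr)
    assume short: "\<not> 2 * l + 2 \<le> length xs"
    note c' = c[unfolded cyc_nth]
    have "col (xs ! i) \<longleftrightarrow> even i" if "i < length xs" for i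
      using that
    proof (induction i)
      case 0
      then show ?case using \<open>col (hd xs)\<close> c' by (simp add: hd_conv_nth)
    next
      case (Suc i)
      then show ?case using c' col by fastforce
    qed
    then have "odd (length xs - 1)"
      using c' col[of "xs ! (length xs - 1)" "xs ! 0"] by (metis diff_less even_zero gr_zeroI
          less_numeral_extra(1) not_numeral_le_zero)
    then have "even (length xs)" using c' by simp
    then obtain j where j: "length xs = 2 * j" by blast
    then have "2 \<le> j" "j \<le> l" using c' short by auto
    obtain v a where v: "xs = v # a" using c' by (cases xs) auto
    define p where "p = take (j - 1) a"
    define w where "w = a ! (j - 1)"
    define q where "q = drop j a"
    have len: "length a = 2 * j - 1" using j v by simp
    then have a: "a = p @ w # q" using \<open>2 \<le> j\<close> id_take_nth_drop[of "j - 1" a]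
      unfolding p_def w_def q_def by simp
    have lp: "length p = j - 1" "length q = j - 1" using len \<open>2 \<le> j\<close> by (auto simp: p_def q_def)
    have suc: "successively (\<lambda>a b. (a, b) \<in> E) (v # p @ w # q)" "(last (w # q), v) \<in> E"
      "distinct (v # p @ w # q)"
      using c v a unfolding cyc_def by auto
    have "successively (\<lambda>a b. (a, b) \<in> E) ((v # p @ [w]) @ q)" using suc(1) by simp
    then have 1: "nbw E (v # p @ [w])" using suc(3)
      unfolding successively_append_iff by (intro nbw_if_distinct) auto
    have "successively (\<lambda>a b. (a, b) \<in> E) ((v # p) @ w # q)" using suc(1) by simp
    then have "successively (\<lambda>a b. (a, b) \<in> E) (w # q)" unfolding successively_append_iff by blast
    then have "successively (\<lambda>a b. (b, a) \<in> E) (w # q)"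
      by (rule successively_mono) (use assms(1) in \<open>auto dest: symD\<close>)
    then have "successively (\<lambda>a b. (a, b) \<in> E) (rev (w # q))" by (simp only: successively_rev)
    then have "successively (\<lambda>a b. (a, b) \<in> E) (v # rev (w # q))"
      using suc(2) assms(1) by (subst successively_Cons) (auto simp: hd_rev hd_append dest: symD)
    then have 2: "nbw E (v # rev q @ [w])" using suc(3) by (intro nbw_if_distinct) auto
    have "(v, hd (p @ [w])) \<in> E" using 1 by (cases p) (auto simp: nbw_Cons)
    then have "uniq_ends E j v"
      using uniq_ends_antimono[OF ext] uniq \<open>col (hd xs)\<close> v \<open>j \<le> l\<close> by (metis list.sel(1))
    from this[unfolded uniq_ends_def, rule_format, of "p @ [w]" "rev q @ [w]"]
    have "p @ [w] = rev q @ [w]" using 1 2 lp \<open>2 \<le> j\<close> by simp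
    then have "set p = set q" by simp
    moreover have "p \<noteq> []" using lp \<open>2 \<le> j\<close> by auto
    ultimately show False using suc(3) by auto
  qed
  obtain x y zs where xs: "xs = x # y # zs" "(x, y) \<in> E"
    using assms(5) unfolding cyc_def by (cases xs rule: remdups_adj.cases) auto
  show ?thesis
  proof (cases "col x")
    case True
    then show ?thesis using main[of xs] assms(5) xs by simp
  next
    case False
    then show ?thesis using main[of "rotate1 xs"] assms(5) cyc_rotate1[of E xs] xs col by force
  qed
qed

fun reach :: "('a \<Rightarrow> 'a list) \<Rightarrow> nat \<Rightarrow> 'a \<Rightarrow> 'a \<Rightarrow> 'a list" where
  "reach N 0 p v = [v]"
| "reach N (Suc l) p v = concat (map (reach N l v) (filter (\<lambda>w. w \<noteq> p) (N v)))"

lemma distinct_concat_mapD: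
  assumes "distinct (concat (map f ws))"
  shows "a \<in> set ws \<Longrightarrow> distinct (f a)"
    and "a \<in> set ws \<Longrightarrow> b \<in> set ws \<Longrightarrow> z \<in> set (f a) \<Longrightarrow> z \<in> set (f b) \<Longrightarrow> a = b"
  using assms by (induction ws) auto

lemma last_in_reach:
  assumes N: "\<forall>x y. (x, y) \<in> E \<longrightarrow> y \<in> set (N x)"
  shows "nbw E (p # v # xs) \<Longrightarrow> last (v # xs) \<in> set (reach N (length xs) p v)"
proof (induction xs arbitrary: p v)
  case (Cons x xs)
  then have "last (x # xs) \<in> set (reach N (length xs) v x)" "x \<noteq> p" "(v, x) \<in> E"
    by (auto simp: nbw_Cons)
  moreover have "x \<in> set (N v)" using N \<open>(v, x) \<in> E\<close> by blast
  ultimately show ?case by auto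
qed simp

lemma reach_inj:
  assumes N: "\<forall>x y. (x, y) \<in> E \<longrightarrow> y \<in> set (N x)"
  shows "distinct (reach N (length xs) p v) \<Longrightarrow> nbw E (p # v # xs) \<Longrightarrow> nbw E (p # v # ys) \<Longrightarrow>
    length ys = length xs \<Longrightarrow> last (v # xs) = last (v # ys) \<Longrightarrow> xs = ys"
proof (induction xs arbitrary: p v ys)
  case (Cons x xs)
  then obtain y ys' where ys: "ys = y # ys'" by (cases ys) auto
  let ?ws = "filter (\<lambda>w. w \<noteq> p) (N v)"
  have xy: "x \<in> set ?ws" "y \<in> set ?ws" using Cons.prems(2,3) N unfolding ys by (auto simp: nbw_Cons)
  have nb: "nbw E (v # x # xs)" "nbw E (v # y # ys')"
    using Cons.prems(2,3) unfolding ys by (auto simp: nbw_Cons)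
  have l: "length ys' = length xs" "last (x # xs) = last (y # ys')"
    using Cons.prems(4,5) unfolding ys by auto
  have d: "distinct (concat (map (reach N (length xs) v) ?ws))" using Cons.prems(1) by simp
  have "x = y"
    using distinct_concat_mapD(2)[OF d xy] last_in_reach[OF N nb(1)] last_in_reach[OF N nb(2)] l by metis
  moreover have "xs = ys'"
    by (rule Cons.IH[OF distinct_concat_mapD(1)[OF d xy(1)] nb(1)])
      (use nb(2) l \<open>x = y\<close> in simp_all)
  ultimately show ?case using ys by simp
qed simp

lemma uniq_ends_if_distinct_reach:
  assumes N: "\<forall>x y. (x, y) \<in> E \<longrightarrow> y \<in> set (N x)"
    and d: "distinct (concat (map (reach N l v) (N v)))"
  shows "uniq_ends E (Suc l) v"
  unfolding uniq_ends_def
proof (intro allI impI, elim conjE)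
  fix p q
  assume p: "nbw E (v # p)" "length p = Suc l" and q: "nbw E (v # q)" "length q = Suc l"
    and eq: "last (v # p) = last (v # q)"
  obtain x xs where xs: "p = x # xs" "length xs = l" using p(2) by (cases p) auto
  obtain y ys where ys: "q = y # ys" "length ys = l" using q(2) by (cases q) auto
  have xy: "x \<in> set (N v)" "y \<in> set (N v)" using p(1) q(1) N unfolding xs ys by (auto simp: nbw_Cons)
  have "last (x # xs) \<in> set (reach N l v x)" "last (y # ys) \<in> set (reach N l v y)"
    using last_in_reach[OF N, of v x xs] last_in_reach[OF N, of v y ys] p(1) q(1) xs ys by simp_all
  then have "x = y" using distinct_concat_mapD(2)[OF d xy] eq xs ys by simp
  then show "p = q"
    using reach_inj[OF N, of xs v x ys] distinct_concat_mapD(1)[OF d xy(1)] p(1) q(1) eq xs ys by simp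
qed

section \<open>Hamiltonian cycles with chords\<close>

text \<open>Sets of binary numerals. With constructor patterns only, an insertion takes as many rewrite steps as
  the numeral has bits; this makes the checks below feasible for the simplifier.\<close>
datatype trie = Leaf | Node bool trie trie

fun ins :: "num \<Rightarrow> trie \<Rightarrow> trie option" where
  "ins num.One Leaf = Some (Node True Leaf Leaf)"
| "ins (num.Bit0 k) Leaf = map_option (\<lambda>t. Node False t Leaf) (ins k Leaf)"
| "ins (num.Bit1 k) Leaf = map_option (\<lambda>t. Node False Leaf t) (ins k Leaf)"
| "ins num.One (Node b l r) = (if b then None else Some (Node True l r))"
| "ins (num.Bit0 k) (Node b l r) = map_option (\<lambda>t. Node b t r) (ins k l)"
| "ins (num.Bit1 k) (Node b l r) = map_option (\<lambda>t. Node b l t) (ins k r)"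

fun mem :: "trie \<Rightarrow> num \<Rightarrow> bool" where
  "mem Leaf k = False"
| "mem (Node b l r) num.One = b"
| "mem (Node b l r) (num.Bit0 k) = mem l k"
| "mem (Node b l r) (num.Bit1 k) = mem r k"

lemma mem_ins: "ins k T = Some T' \<Longrightarrow> \<not> mem T k \<and> (\<forall>j. mem T' j \<longleftrightarrow> j = k \<or> mem T j)"
proof (induction k T arbitrary: T' rule: ins.induct)
  case 1
  have "mem (Node True Leaf Leaf) j \<longleftrightarrow> j = num.One" for j by (cases j) auto
  then show ?case using 1 by auto
next
  case (2 k)
  then obtain t where t: "ins k Leaf = Some t" "T' = Node False t Leaf" by auto
  have "mem T' j \<longleftrightarrow> j = num.Bit0 k" for j using 2(1)[OF t(1)] t(2) by (cases j) auto
  then show ?case by simp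
next
  case (3 k)
  then obtain t where t: "ins k Leaf = Some t" "T' = Node False Leaf t" by auto
  have "mem T' j \<longleftrightarrow> j = num.Bit1 k" for j using 3(1)[OF t(1)] t(2) by (cases j) auto
  then show ?case by simp
next
  case (4 b l r)
  then have "\<not> b" "T' = Node True l r" by (auto split: if_splits)
  moreover have "mem (Node True l r) j \<longleftrightarrow> j = num.One \<or> mem (Node b l r) j" for j by (cases j) auto
  ultimately show ?case by simp
next
  case (5 k b l r)
  then obtain t where t: "ins k l = Some t" "T' = Node b t r" by auto
  have "mem T' j \<longleftrightarrow> j = num.Bit0 k \<or> mem (Node b l r) j" for j using 5(1)[OF t(1)] t(2) by (cases j) auto
  then show ?case using 5(1)[OF t(1)] by simp
next
  case (6 k b l r)
  then obtain t where t: "ins k r = Some t" "T' = Node b l t" by auto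
  have "mem T' j \<longleftrightarrow> j = num.Bit1 k \<or> mem (Node b l r) j" for j using 6(1)[OF t(1)] t(2) by (cases j) auto
  then show ?case using 6(1)[OF t(1)] by simp
qed

fun fresh :: "num list \<Rightarrow> trie option \<Rightarrow> bool" where
  "fresh xs None = False"
| "fresh [] (Some T) = True"
| "fresh (x # xs) (Some T) = fresh xs (ins x T)"

lemma distinct_if_fresh: "fresh xs (Some T) \<Longrightarrow> distinct xs \<and> (\<forall>x \<in> set xs. \<not> mem T x)"
proof (induction xs arbitrary: T)
  case (Cons x xs)
  then obtain T' where "ins x T = Some T'" by (cases "ins x T") auto
  then show ?case using Cons mem_ins[of x T T'] by auto
qed simp

definition no_repetition :: "num list \<Rightarrow> bool" where
  "no_repetition xs = fresh xs (Some Leaf)"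

lemma distinct_if_no_repetition: "no_repetition xs \<Longrightarrow> distinct xs"
  using distinct_if_fresh by (auto simp: no_repetition_def)

definition right :: "num \<Rightarrow> num \<Rightarrow> num" where
  "right n v = (if v = n then num.One else Num.inc v)"

fun dec :: "num \<Rightarrow> num" where
  "dec num.One = num.One"
| "dec (num.Bit0 k) = Num.BitM k"
| "dec (num.Bit1 k) = num.Bit0 k"

definition left :: "num \<Rightarrow> num \<Rightarrow> num" where
  "left n v = (if v = num.One then n else dec v)"

fun even_num :: "num \<Rightarrow> bool" where
  "even_num num.One = False"
| "even_num (num.Bit0 k) = True"
| "even_num (num.Bit1 k) = False"

text \<open>The ends of the walks of length \<open>l\<close> that continue a step along the cycle from the left
  or from the right, or a step along a chord, in front of \<open>ys\<close>. Keeping track of the kind of the last step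
  replaces the comparison with the previous vertex.\<close>
fun from_left from_right from_chord ::
  "num \<Rightarrow> (num \<Rightarrow> num) \<Rightarrow> nat \<Rightarrow> num \<Rightarrow> num list \<Rightarrow> num list" where
  "from_left n f 0 v ys = v # ys"
| "from_right n f 0 v ys = v # ys"
| "from_chord n f 0 v ys = v # ys"
| "from_left n f (Suc l) v ys = from_left n f l (right n v) (from_chord n f l (f v) ys)"
| "from_right n f (Suc l) v ys = from_right n f l (left n v) (from_chord n f l (f v) ys)"
| "from_chord n f (Suc l) v ys = from_left n f l (right n v) (from_right n f l (left n v) ys)"

definition ends :: "num \<Rightarrow> (num \<Rightarrow> num) \<Rightarrow> nat \<Rightarrow> num \<Rightarrow> num list" where
  "ends n f l v =
     from_left n f l (right n v) (from_right n f l (left n v) (from_chord n f l (f v) []))"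

text \<open>The parameter \<open>D\<close> is \<open>distinct\<close> in proofs and \<open>no_repetition\<close> in computations. Together with the first
  step, the walks have length 5; they start at the even vertices only, which are one side of the bipartition.\<close>
definition chord_ok :: "(num list \<Rightarrow> bool) \<Rightarrow> num \<Rightarrow> (num \<Rightarrow> num) \<Rightarrow> num \<Rightarrow> bool" where
  "chord_ok D n f v \<longleftrightarrow> f v \<le> n \<and> f (f v) = v \<and> even_num (f v) = (\<not> even_num v) \<and>
     f v \<noteq> right n v \<and> f v \<noteq> left n v \<and> right n v \<noteq> left n v \<and>
     (even_num v \<longrightarrow> D (ends n f (Suc (Suc (Suc (Suc 0)))) v))"

fun adj :: "num \<Rightarrow> (num \<Rightarrow> num) \<Rightarrow> num \<Rightarrow> num \<Rightarrow> bool" where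
  "adj n f u v \<longleftrightarrow> v = right n u \<or> v = left n u \<or> v = f u"

text \<open>A walk that returns from its last vertex to \<open>z\<close>.\<close>
fun path_ok :: "num \<Rightarrow> (num \<Rightarrow> num) \<Rightarrow> num \<Rightarrow> num list \<Rightarrow> bool" where
  "path_ok n f z [] = False"
| "path_ok n f z [x] = (x \<le> n \<and> adj n f x z)"
| "path_ok n f z (x # y # xs) = (x \<le> n \<and> adj n f x y \<and> path_ok n f z (y # xs))"

text \<open>A function given by a table. As a premise, this turns into one rewrite rule for each argument, so that
  the table is not carried along as a term during the computation.\<close>
fun tab :: "(num \<Rightarrow> num) \<Rightarrow> num \<Rightarrow> num list \<Rightarrow> bool" where
  "tab f k [] = True"
| "tab f k (x # xs) = (f k = x \<and> tab f (Num.inc k) xs)"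

fun upto_num :: "num \<Rightarrow> 'a list \<Rightarrow> num list" where
  "upto_num k [] = []"
| "upto_num k (x # xs) = k # upto_num (Num.inc k) xs"

lemma inc_le: "k < n \<Longrightarrow> Num.inc k \<le> n" for k n :: num
  by (simp add: less_num_def less_eq_num_def nat_of_num_inc)

lemma inc_dec: "k \<noteq> num.One \<Longrightarrow> Num.inc (dec k) = k"
  by (cases k) (auto simp: inc_BitM_eq)

lemma dec_inc: "dec (Num.inc k) = k"
  by (induction k) (auto simp: BitM_inc_eq)

lemma inc_neq_One: "Num.inc k \<noteq> num.One" by (cases k) auto

lemma even_inc: "even_num (Num.inc k) \<longleftrightarrow> \<not> even_num k" by (cases k) auto

lemma nat_of_dec: "k \<noteq> num.One \<Longrightarrow> nat_of_num k = Suc (nat_of_num (dec k))"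
  by (metis inc_dec nat_of_num_inc)

lemma right_le: "v \<le> n \<Longrightarrow> right n v \<le> n"
  using inc_le[of v n] by (cases "v = n") (auto simp: right_def order.order_iff_strict[of v n])

lemma left_le: "v \<le> n \<Longrightarrow> left n v \<le> n"
  by (cases "v = num.One") (auto simp: left_def less_eq_num_def nat_of_dec)

text \<open>The vertices are \<open>1, \<dots>, n\<close>, the Hamiltonian cycle is \<open>1, 2, \<dots>, n, 1\<close>, the chord at \<open>v\<close> leads to
  \<open>f v\<close>, and \<open>cs\<close> is a cycle of length 12.\<close>
locale chord_cycle =
  fixes n :: num and f :: "num \<Rightarrow> num" and cs :: "num list"
  assumes n: "even_num n"
    and ok: "\<And>v. v \<le> n \<Longrightarrow> chord_ok distinct n f v"
    and cs: "distinct cs" "length cs = 12" "path_ok n f (hd cs) cs"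
begin

abbreviation "R \<equiv> right n"
abbreviation "L \<equiv> left n"

definition V :: "num set" where "V = {v. v \<le> n}"
definition N :: "num \<Rightarrow> num list" where "N v = [R v, L v, f v]"
definition E :: "num rel" where "E = {(u, v). u \<in> V \<and> v \<in> set (N u)}"

lemma R_V: "v \<in> V \<Longrightarrow> R v \<in> V"
  by (simp add: V_def right_le)

lemma L_V: "v \<in> V \<Longrightarrow> L v \<in> V"
  by (simp add: V_def left_le)

lemma LR: "v \<in> V \<Longrightarrow> L (R v) = v"
  by (auto simp: right_def left_def dec_inc inc_neq_One)

lemma RL: "v \<in> V \<Longrightarrow> R (L v) = v"
  by (auto simp: right_def left_def inc_dec V_def less_eq_num_def nat_of_dec)

lemma f: "v \<in> V \<Longrightarrow> f v \<in> V" "v \<in> V \<Longrightarrow> f (f v) = v"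
  using ok by (auto simp: V_def chord_ok_def)

lemma distinct_N: "v \<in> V \<Longrightarrow> distinct (N v)"
  using ok unfolding V_def N_def chord_ok_def by fastforce

lemma even_step: "(u, v) \<in> E \<Longrightarrow> even_num u \<noteq> even_num v"
proof -
  have R: "even_num u \<noteq> even_num (R u)" if "u \<in> V" for u
    using n by (auto simp: right_def even_inc)
  moreover have "even_num u \<noteq> even_num (L u)" if "u \<in> V" for u
    using R[of "L u"] L_V RL that by auto
  moreover have "even_num u \<noteq> even_num (f u)" if "u \<in> V" for u
    using ok that by (auto simp: V_def chord_ok_def)
  ultimately show "(u, v) \<in> E \<Longrightarrow> even_num u \<noteq> even_num v" by (auto simp: E_def N_def)
qed

lemma sym_E: "sym E"
  by (rule symI) (auto simp: E_def N_def R_V L_V f LR RL)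

text \<open>The vertex before a step to the right is the left neighbour, and so on.\<close>
lemma reach_from:
  "v \<in> V \<Longrightarrow>
    from_left n f l v ys = reach N l (L v) v @ ys \<and>
    from_right n f l v ys = reach N l (R v) v @ ys \<and>
    from_chord n f l v ys = reach N l (f v) v @ ys"
proof (induction l arbitrary: v ys)
  case (Suc l)
  have N: "N v = [R v, L v, f v]" by (simp add: N_def)
  have d: "R v \<noteq> L v" "L v \<noteq> R v" "R v \<noteq> f v" "f v \<noteq> R v" "L v \<noteq> f v" "f v \<noteq> L v"
    using distinct_N[OF Suc.prems] by (auto simp: N)
  show ?case
    using d Suc.IH[OF R_V[OF Suc.prems]] Suc.IH[OF L_V[OF Suc.prems]] Suc.IH[OF f(1)[OF Suc.prems]]
    by (simp add: N LR RL f Suc.prems)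
qed simp

lemma ends: "v \<in> V \<Longrightarrow> ends n f l v = concat (map (reach N l v) (N v))"
  by (simp add: ends_def reach_from R_V L_V f LR RL N_def[of v])

lemma in_spectrum: "nat_of_num n \<in> kg_spectrum 3 12"
proof -
  have N: "\<forall>x y. (x, y) \<in> E \<longrightarrow> y \<in> set (N x)" by (simp add: E_def)
  have sub: "E \<subseteq> V \<times> V" by (auto simp: E_def N_def R_V L_V f)
  have nbrs: "E `` {v} = set (N v)" if "v \<in> V" for v using that by (auto simp: E_def)
  have V: "nat_of_num ` V = {1..nat_of_num n}"
  proof (intro equalityI subsetI)
    fix i assume "i \<in> {1..nat_of_num n}"
    then have "i = nat_of_num (num_of_nat i)" "num_of_nat i \<in> V"
      by (simp_all add: V_def less_eq_num_def num_of_nat_inverse)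
    then show "i \<in> nat_of_num ` V" by blast
  qed (auto simp: V_def less_eq_num_def nat_of_num_pos Suc_leI)
  have inj: "inj_on nat_of_num V" by (simp add: inj_on_def num_eq_iff)
  have "card V = nat_of_num n" using card_image[OF inj] V by simp
  have ext: "\<forall>u v a b. (u, v) \<in> E \<longrightarrow> (\<exists>c. (v, c) \<in> E \<and> c \<noteq> a \<and> c \<noteq> b)"
  proof (intro allI impI)
    fix u v a b assume "(u, v) \<in> E"
    then have "v \<in> V" using sub by auto
    then show "\<exists>c. (v, c) \<in> E \<and> c \<noteq> a \<and> c \<noteq> b"
      using distinct_N[of v] by (auto simp: E_def N_def)
  qed
  have "kg_rel V E 3 12"
  proof
    show "finite V" using V inj by (metis finite_atLeastAtMost finite_image_iff)
    show "V \<noteq> {}" by (auto simp: V_def)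
    show "E \<subseteq> V \<times> V" by (rule sub)
    show "sym E" by (rule sym_E)
    show "irrefl E" using even_step by (auto simp: irrefl_def)
    show "card (E `` {v}) = 3" if "v \<in> V" for v
      using distinct_card[OF distinct_N[OF that]] nbrs[OF that] by (simp add: N_def)
    show "(u, v) \<in> E\<^sup>*" if "u \<in> V" "v \<in> V" for u v
    proof -
      have to: "(num.One, v) \<in> E\<^sup>*" if "v \<in> V" for v
        using that
      proof (induction "nat_of_num v" arbitrary: v)
        case (Suc i)
        show ?case
        proof (cases "v = num.One")
          case False
          then have "i = nat_of_num (L v)"
            using Suc.hyps(2) by (simp add: left_def nat_of_dec)
          then have "(num.One, L v) \<in> E\<^sup>*" using Suc.hyps(1) L_V[OF Suc.prems] by blast
          moreover have "(L v, v) \<in> E" using Suc.prems L_V RL by (simp add: E_def N_def)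
          ultimately show ?thesis by (rule rtrancl_into_rtrancl)
        qed simp
      qed (simp add: nat_of_num_pos less_not_refl2)
      have "sym (E\<^sup>*)" using sym_E by (rule sym_rtrancl)
      then have "(u, num.One) \<in> E\<^sup>*" using to[OF that(1)] by (auto dest: symD)
      then show ?thesis using to[OF that(2)] by (rule rtrancl_trans)
    qed
    show "12 \<le> length xs" if "cyc E xs" for xs
    proof -
      have "uniq_ends E 5 v" if "(v, w) \<in> E" "even_num v" for v w
      proof -
        have "v \<in> V" using that sub by auto
        then have "distinct (concat (map (reach N 4 v) (N v)))"
          using ok[of v] that(2) ends[of v]
          by (auto simp: chord_ok_def V_def numeral_eq_Suc)
        then show ?thesis using uniq_ends_if_distinct_reach[OF N, of 4 v] by simp
      qed
      then show ?thesis
        using cyc_ge_if_uniq_ends[OF sym_E ext, of even_num 5 xs] even_step that by auto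
    qed
    show "\<exists>xs. cyc E xs \<and> length xs = 12"
    proof (intro exI conjI)
      have "successively (\<lambda>a b. (a, b) \<in> E) xs \<and> (last xs, z) \<in> E" if "path_ok n f z xs" for z xs
        using that by (induction xs rule: induct_list012) (auto simp: E_def V_def N_def)
      then show "cyc E cs" using cs by (auto simp: cyc_def)
    qed (rule cs(2))
  qed
  from kg_spectrumI[OF this] show ?thesis using \<open>card V = nat_of_num n\<close> by simp
qed

end

text \<open>The representative in \<open>{1..n}\<close> of an integer that misses this interval by less than \<open>n\<close>.\<close>
definition wrap :: "num \<Rightarrow> int \<Rightarrow> num" where
  "wrap n i = num_of_nat (nat (if i < 1 then i + numeral n else if numeral n < i then i - numeral n else i))"

fun targets :: "num \<Rightarrow> int \<Rightarrow> int list \<Rightarrow> num list" where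
  "targets n i [] = []"
| "targets n i (d # ds) = wrap n (i + d) # targets n (i + 1) ds"

lemma exists_tab: "\<exists>f. tab f k xs"
proof (induction xs arbitrary: k)
  case (Cons x xs)
  then obtain f where f: "tab f (Num.inc k) xs" by blast
  have "tab (f(j := y)) k xs" if "tab f k xs" "j < k" for j y k xs and f :: "num \<Rightarrow> num"
    using that
    by (induction f k xs rule: tab.induct)
      (auto simp: less_num_def nat_of_num_inc)
  then have "tab (f(k := x)) (Num.inc k) xs" using f by (auto simp: less_num_def nat_of_num_inc)
  then show ?case by (intro exI[of _ "f(k := x)"]) (simp add: fun_upd_def)
qed simp

lemma list_all_upto_num:
  "list_all P (upto_num num.One xs) \<Longrightarrow> nat_of_num v \<le> length xs \<Longrightarrow> P v"
proof -
  have "list_all P (upto_num k xs) \<Longrightarrow> nat_of_num k \<le> nat_of_num v \<Longrightarrow>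
    nat_of_num v < nat_of_num k + length xs \<Longrightarrow> P v" for k
  proof (induction xs arbitrary: k)
    case (Cons x xs)
    then show ?case by (cases "k = v") (auto simp: nat_of_num_inc num_eq_iff)
  qed simp
  from this[of num.One] show "list_all P (upto_num num.One xs) \<Longrightarrow> nat_of_num v \<le> length xs \<Longrightarrow> P v"
    using nat_of_num_pos[of v] by auto
qed

abbreviation pos :: "num \<Rightarrow> int" where
  "pos v \<equiv> int (nat_of_num v)"

lemma pos_ge_1: "1 \<le> pos v"
  using nat_of_num_pos[of v] by simp

lemma pos_wrap:
  assumes "1 - pos n \<le> i" "i \<le> 2 * pos n"
  shows "wrap n i \<le> n" and "pos (wrap n i) mod pos n = i mod pos n"
proof -
  define j where "j = (if i < 1 then i + pos n else if pos n < i then i - pos n else i)"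
  have j: "1 \<le> j" "j \<le> pos n" "j mod pos n = i mod pos n" using assms by (auto simp: j_def)
  have "(numeral n :: int) = pos n" by (metis nat_of_num_numeral of_nat_numeral)
  then have "wrap n i = num_of_nat (nat j)" by (simp add: wrap_def j_def)
  then have "pos (wrap n i) = j" using j(1) by (simp add: num_of_nat_inverse)
  then show "wrap n i \<le> n" "pos (wrap n i) mod pos n = i mod pos n"
    using j by (simp_all add: less_eq_num_def)
qed

lemma pos_eqI:
  assumes "u \<le> n" "v \<le> n" "pos u mod pos n = pos v mod pos n"
  shows "u = v"
proof -
  have le: "1 \<le> pos u" "1 \<le> pos v" "pos u \<le> pos n" "pos v \<le> pos n"
    using assms pos_ge_1 by (auto simp: less_eq_num_def)
  have "pos n dvd pos u - pos v" using assms(3) by (simp add: mod_eq_dvd_iff)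
  then have "\<bar>pos u - pos v\<bar> < pos n \<Longrightarrow> pos u - pos v = 0"
    using dvd_imp_le_int[of "pos u - pos v" "pos n"] by auto
  then show ?thesis using le by (auto simp: num_eq_iff)
qed

lemma pos_right: "pos (right n v) mod pos n = (pos v + 1) mod pos n"
  by (simp add: right_def nat_of_num_inc add.commute)

lemma pos_left: "pos (left n v) mod pos n = (pos v - 1) mod pos n"
  by (simp add: left_def nat_of_dec)

lemma even_num_iff: "even_num v \<longleftrightarrow> even (nat_of_num v)"
  by (cases v) auto

text \<open>A periodic list of differences makes the rotation by one period an automorphism, so only
  the vertices of the first period have to be examined. Its length must be even for the rotation to preserve
  the two sides.\<close>
locale periodic_chords =
  fixes n :: num and f :: "num \<Rightarrow> num" and m :: nat and os :: "int list"
  assumes n: "m * length os = nat_of_num n" and even: "even (length os)"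
    and bound: "\<And>d. d \<in> set os \<Longrightarrow> \<bar>d\<bar> < pos n"
    and f: "\<And>v. v \<le> n \<Longrightarrow> f v = wrap n (pos v + os ! ((nat_of_num v - 1) mod length os))"
begin

definition shift :: "num \<Rightarrow> num" where
  "shift v = wrap n (pos v + int (length os))"

lemma m_pos: "0 < m" "0 < length os" "int (length os) \<le> pos n"
proof -
  show *: "0 < m" "0 < length os" using n nat_of_num_pos[of n] by (auto simp flip: n intro: gr0I)
  then have "1 * length os \<le> m * length os" by (intro mult_right_mono) auto
  then show "int (length os) \<le> pos n" using n by simp
qed

lemma shift:
  assumes "v \<le> n"
  shows "shift v \<le> n" "pos (shift v) mod pos n = (pos v + int (length os)) mod pos n"
proof -
  have "1 - pos n \<le> pos v + int (length os)" "pos v + int (length os) \<le> 2 * pos n"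
    using assms m_pos pos_ge_1[of v] pos_ge_1[of n] by (simp_all add: less_eq_num_def)
  from pos_wrap[OF this] show "shift v \<le> n"
    "pos (shift v) mod pos n = (pos v + int (length os)) mod pos n"
    unfolding shift_def .
qed

lemma f_le:
  assumes "v \<le> n"
  shows "f v \<le> n"
    and "pos (f v) mod pos n = (pos v + os ! ((nat_of_num v - 1) mod length os)) mod pos n"
proof -
  let ?i = "pos v + os ! ((nat_of_num v - 1) mod length os)"
  have "\<bar>os ! ((nat_of_num v - 1) mod length os)\<bar> < pos n" using m_pos by (intro bound) simp
  then have "1 - pos n \<le> ?i" "?i \<le> 2 * pos n"
    using assms pos_ge_1[of v] unfolding less_eq_num_def by linarith+
  from pos_wrap[OF this] show "f v \<le> n" "pos (f v) mod pos n = ?i mod pos n"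
    unfolding f[OF assms] .
qed

lemma shift_right:
  assumes "v \<le> n"
  shows "right n (shift v) = shift (right n v)"
proof (rule pos_eqI[of _ n])
  let ?t = "int (length os)"
  have "pos (right n (shift v)) mod pos n = (pos (shift v) + 1) mod pos n" by (rule pos_right)
  also have "\<dots> = (pos v + ?t + 1) mod pos n" by (rule mod_add_cong[OF shift(2)[OF assms] refl])
  also have "\<dots> = (pos v + 1 + ?t) mod pos n" by (simp add: algebra_simps)
  also have "\<dots> = (pos (right n v) + ?t) mod pos n" by (rule mod_add_cong[OF pos_right[symmetric] refl])
  also have "\<dots> = pos (shift (right n v)) mod pos n"
    using shift(2)[OF right_le[OF assms]] by simp
  finally show "pos (right n (shift v)) mod pos n = pos (shift (right n v)) mod pos n" .
qed (use assms shift right_le in auto)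

lemma shift_left:
  assumes "v \<le> n"
  shows "left n (shift v) = shift (left n v)"
proof (rule pos_eqI[of _ n])
  let ?t = "int (length os)"
  have "pos (left n (shift v)) mod pos n = (pos (shift v) - 1) mod pos n" by (rule pos_left)
  also have "\<dots> = (pos v + ?t - 1) mod pos n" by (rule mod_diff_cong[OF shift(2)[OF assms] refl])
  also have "\<dots> = (pos v - 1 + ?t) mod pos n" by (simp add: algebra_simps)
  also have "\<dots> = (pos (left n v) + ?t) mod pos n" by (rule mod_add_cong[OF pos_left[symmetric] refl])
  also have "\<dots> = pos (shift (left n v)) mod pos n"
    using shift(2)[OF left_le[OF assms]] by simp
  finally show "pos (left n (shift v)) mod pos n = pos (shift (left n v)) mod pos n" .
qed (use assms shift left_le in auto)

lemma shift_index:
  assumes "v \<le> n"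
  shows "(nat_of_num (shift v) - 1) mod length os = (nat_of_num v - 1) mod length os"
proof -
  let ?t = "int (length os)"
  have dvd: "?t dvd pos n" by (simp flip: n)
  have "(pos (shift v) - 1) mod pos n = (pos v + ?t - 1) mod pos n"
    by (rule mod_diff_cong[OF shift(2)[OF assms] refl])
  from arg_cong[OF this, of "\<lambda>x. x mod ?t"]
  have "(pos (shift v) - 1) mod ?t = (pos v + ?t - 1) mod ?t"
    unfolding mod_mod_cancel[OF dvd] .
  also have "\<dots> = (pos v - 1) mod int (length os)"
    by (metis add_diff_eq diff_add_eq mod_add_self2)
  finally have "int ((nat_of_num (shift v) - 1) mod length os) = int ((nat_of_num v - 1) mod length os)"
    using nat_of_num_pos[of v] nat_of_num_pos[of "shift v"] by (simp add: zmod_int of_nat_diff)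
  then show ?thesis by simp
qed

lemma shift_f:
  assumes "v \<le> n"
  shows "f (shift v) = shift (f v)"
proof (rule pos_eqI[of _ n])
  let ?d = "os ! ((nat_of_num v - 1) mod length os)" and ?t = "int (length os)"
  have "pos (f (shift v)) mod pos n = (pos (shift v) + ?d) mod pos n"
    using f_le(2)[OF shift(1)[OF assms]] shift_index[OF assms] by simp
  also have "\<dots> = (pos v + ?t + ?d) mod pos n" by (rule mod_add_cong[OF shift(2)[OF assms] refl])
  also have "\<dots> = (pos v + ?d + ?t) mod pos n" by (simp add: algebra_simps)
  also have "\<dots> = (pos (f v) + ?t) mod pos n" by (rule mod_add_cong[OF f_le(2)[OF assms, symmetric] refl])
  also have "\<dots> = pos (shift (f v)) mod pos n" using shift(2)[OF f_le(1)[OF assms]] by simp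
  finally show "pos (f (shift v)) mod pos n = pos (shift (f v)) mod pos n" .
qed (use assms shift f_le in auto)

lemma inj_shift: "u \<le> n \<Longrightarrow> v \<le> n \<Longrightarrow> shift u = shift v \<longleftrightarrow> u = v"
proof -
  assume le: "u \<le> n" "v \<le> n"
  have "u = v" if "shift u = shift v"
  proof (rule pos_eqI[OF le])
    have "(pos u + int (length os)) mod pos n = (pos v + int (length os)) mod pos n"
      using shift(2) le that by metis
    then show "pos u mod pos n = pos v mod pos n" by (simp add: mod_eq_dvd_iff)
  qed
  then show ?thesis by auto
qed

lemma even_shift:
  assumes "v \<le> n"
  shows "even_num (shift v) \<longleftrightarrow> even_num v"
proof -
  have "even (pos n)" using even n by (metis even_mult_iff even_of_nat)
  then have "even (pos (shift v)) \<longleftrightarrow> even (pos v + int (length os))"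
    using shift(2)[OF assms] by (metis dvd_mod_iff)
  then show ?thesis using even by (simp add: even_num_iff)
qed

lemma from_shift:
  "v \<le> n \<Longrightarrow>
    from_left n f l (shift v) (map shift ys) = map shift (from_left n f l v ys) \<and>
    from_right n f l (shift v) (map shift ys) = map shift (from_right n f l v ys) \<and>
    from_chord n f l (shift v) (map shift ys) = map shift (from_chord n f l v ys)"
proof (induction l arbitrary: v ys)
  case (Suc l)
  then show ?case by (simp add: shift_right shift_left shift_f right_le left_le f_le)
qed simp

lemma ends_le:
  "v \<le> n \<Longrightarrow> set ys \<subseteq> {..n} \<Longrightarrow>
    set (from_left n f l v ys) \<subseteq> {..n} \<and> set (from_right n f l v ys) \<subseteq> {..n} \<and>
    set (from_chord n f l v ys) \<subseteq> {..n}"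
proof (induction l arbitrary: v ys)
  case (Suc l)
  then show ?case by (simp add: right_le left_le f_le)
qed simp

lemma chord_ok_shift:
  assumes "v \<le> n" "chord_ok distinct n f v"
  shows "chord_ok distinct n f (shift v)"
proof -
  have "ends n f l (shift v) = map shift (ends n f l v)" for l
    using from_shift[of "right n v"] from_shift[of "left n v"] from_shift[of "f v" l "[]"] assms(1)
    by (simp add: ends_def shift_right shift_left shift_f right_le left_le f_le)
  moreover have "set (ends n f l v) \<subseteq> {..n}" for l
    using assms(1) by (simp add: ends_def ends_le right_le left_le f_le)
  then have "inj_on shift (set (ends n f l v))" for l
    using inj_shift by (intro inj_onI) (meson atMost_iff subsetD)
  ultimately have "distinct (ends n f l (shift v)) \<longleftrightarrow> distinct (ends n f l v)" for l
    by (simp add: distinct_map)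
  then show ?thesis
    using assms unfolding chord_ok_def
    by (simp add: shift shift_right shift_left shift_f right_le left_le f_le inj_shift even_shift)
qed

lemma chord_ok_all:
  assumes "\<And>v. nat_of_num v \<le> length os \<Longrightarrow> chord_ok distinct n f v" and "v \<le> n"
  shows "chord_ok distinct n f v"
  using assms(2)
proof (induction "nat_of_num v" arbitrary: v rule: less_induct)
  case less
  show ?case
  proof (cases "nat_of_num v \<le> length os")
    case False
    define u where "u = num_of_nat (nat_of_num v - length os)"
    have u: "nat_of_num u = nat_of_num v - length os" using False by (simp add: u_def num_of_nat_inverse)
    then have "u \<le> n" using less.prems by (simp add: less_eq_num_def)
    have "shift u = v"
      using shift[OF \<open>u \<le> n\<close>] less.prems u False by (intro pos_eqI[of _ n]) (auto simp: of_nat_diff)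
    moreover have "chord_ok distinct n f u" using less.hyps \<open>u \<le> n\<close> u m_pos False by simp
    ultimately show ?thesis using chord_ok_shift \<open>u \<le> n\<close> by metis
  qed (use assms(1) in simp)
qed

end

lemma tab_nth:
  "tab f k xs \<Longrightarrow> i < length xs \<Longrightarrow> nat_of_num v = nat_of_num k + i \<Longrightarrow> f v = xs ! i"
proof (induction f k xs arbitrary: i rule: tab.induct)
  case (2 f k x xs)
  then show ?case by (cases i) (auto simp: nat_of_num_inc num_eq_iff[symmetric])
qed simp

lemma targets_nth: "i < length ds \<Longrightarrow> targets n j ds ! i = wrap n (j + int i + ds ! i)"
proof (induction ds arbitrary: i j)
  case (Cons d ds)
  then show ?case by (cases i) (auto simp: algebra_simps)
qed simp

lemma nth_concat_replicate:
  "i < m * length xs \<Longrightarrow> concat (replicate m xs) ! i = xs ! (i mod length xs)"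
proof (induction m arbitrary: i)
  case (Suc m)
  then show ?case by (cases "i < length xs") (auto simp: nth_append le_mod_geq)
qed simp

definition chords_ok :: "num \<Rightarrow> (num \<Rightarrow> num) \<Rightarrow> 'a list \<Rightarrow> num list \<Rightarrow> bool" where
  "chords_ok n f os cs \<longleftrightarrow> list_all (chord_ok no_repetition n f) (upto_num num.One os) \<and>
     no_repetition cs \<and> path_ok n f (hd cs) cs"

text \<open>The last premise is universal in \<open>f\<close> in order that \<open>f\<close> is a free variable during the computation,
  known only through the table.\<close>
lemma lcf_spectrum:
  assumes "m * length os = numeral n \<and> even (length os) \<and> list_all (\<lambda>d. \<bar>d\<bar> < numeral n) os \<and>
      length cs = 12"
    and "\<And>f. tab f num.One (targets n 1 (concat (replicate m os))) \<Longrightarrow>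
      chords_ok n f os (map num_of_nat cs)"
  shows "numeral n \<in> kg_spectrum 3 12"
proof -
  let ?ds = "concat (replicate m os)"
  obtain f where tab: "tab f num.One (targets n 1 ?ds)" using exists_tab by blast
  then have ok: "chords_ok n f os (map num_of_nat cs)" by (rule assms(2))
  have len: "length (targets n i ds) = length ds" for i ds by (induction ds arbitrary: i) auto
  have n: "m * length os = nat_of_num n" using assms(1) by (simp add: nat_of_num_numeral)
  interpret periodic_chords n f m os
  proof
    show "m * length os = nat_of_num n" "even (length os)" using n assms(1) by auto
    have "(numeral n :: int) = pos n" by (metis nat_of_num_numeral of_nat_numeral)
    then show "\<bar>d\<bar> < pos n" if "d \<in> set os" for d using assms(1) that by (auto simp: list_all_iff)
    show "f v = wrap n (pos v + os ! ((nat_of_num v - 1) mod length os))" if "v \<le> n" for v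
    proof -
      have i: "nat_of_num v - 1 < m * length os" "nat_of_num v = nat_of_num num.One + (nat_of_num v - 1)"
        using that nat_of_num_pos[of v] n by (auto simp: less_eq_num_def)
      moreover have "length ?ds = m * length os" by (simp add: length_concat sum_list_replicate)
      ultimately have "f v = wrap n (1 + int (nat_of_num v - 1) + os ! ((nat_of_num v - 1) mod length os))"
        using tab_nth[OF tab, of "nat_of_num v - 1" v] len[of 1 ?ds]
        by (simp add: targets_nth nth_concat_replicate)
      then show ?thesis using i(2) by simp
    qed
  qed
  have imp: "chord_ok no_repetition n f v \<Longrightarrow> chord_ok distinct n f v" for v
    using distinct_if_no_repetition by (auto simp: chord_ok_def)
  interpret chord_cycle n f "map num_of_nat cs"
  proof
    show "even_num n" using n even by (metis even_mult_iff even_num_iff)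
    show "chord_ok distinct n f v" if "v \<le> n" for v
      using ok chord_ok_all[OF imp that] list_all_upto_num[of "chord_ok no_repetition n f" os]
      by (auto simp: chords_ok_def)
  qed (use ok assms(1) distinct_if_no_repetition in \<open>auto simp: chords_ok_def\<close>)
  show ?thesis using in_spectrum by (simp add: nat_of_num_numeral)
qed

section \<open>The graphs\<close>

lemma num_of_nat_numeral: "num_of_nat (numeral k) = k"
  by (metis nat_of_num_inverse nat_of_num_numeral)

lemma replicate_numeral: "replicate (numeral k) x = x # replicate (pred_numeral k) x"
  by (simp add: numeral_eq_Suc)

text \<open>The first set of rules expands the LCF notation to a table of chords, the second one performs the check.
  The table must not be taken apart before the differences have been evaluated.\<close>

declare tab.simps [simp del]

lemmas expand_simps = wrap_def num_of_nat_numeral replicate_numeral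

lemmas check_simps = chords_ok_def chord_ok_def ends_def from_left.simps from_right.simps
  from_chord.simps no_repetition_def fresh.simps ins.simps right_def left_def dec.simps even_num.simps adj.simps
  path_ok.simps tab.simps upto_num.simps Num.inc.simps Num.BitM.simps list.pred_inject list.sel
  num.distinct num.inject simp_thms if_True if_False option.map le_num_simps less_num_simps

text \<open>The arguments of \<open>lcf_spectrum\<close> are the number of periods, the differences in one period, and a cycle of
  length 12.\<close>


lemma order_126: "126 \<in> kg_spectrum 3 12"
  by (rule lcf_spectrum[of 7
      "[-31, -59, -45, 55, -55, 31, 39, 57, -47, -39, -57, 45, -35, 35, 59, 47, -17, 17]" _
      "[1, 2, 3, 84, 85, 86, 121, 122, 123, 124, 125, 126]"],
    simp, simp add: expand_simps, simp only: check_simps cong: if_weak_cong)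

lemma order_162: "162 \<in> kg_spectrum 3 12"
  by (rule lcf_spectrum[of 27
      "[-67, -11, 11, 43, -43, 67]" _
      "[1, 2, 153, 154, 155, 156, 157, 158, 159, 160, 161, 162]"],
    simp, simp add: expand_simps, simp only: check_simps cong: if_weak_cong)

lemma order_168: "168 \<in> kg_spectrum 3 12"
  by (rule lcf_spectrum[of 14
      "[-79, -39, 19, 29, 63, 79, -79, -63, -29, -19, 39, 79]" _
      "[1, 2, 131, 130, 129, 100, 101, 164, 165, 166, 167, 168]"],
    simp, simp add: expand_simps, simp only: check_simps cong: if_weak_cong)

lemma order_180: "180 \<in> kg_spectrum 3 12"
  by (rule lcf_spectrum[of 30
      "[-17, 17, 43, -43, -77, 77]" _
      "[1, 2, 19, 20, 37, 38, 39, 40, 177, 178, 179, 180]"],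
    simp, simp add: expand_simps, simp only: check_simps cong: if_weak_cong)

lemma order_182: "182 \<in> kg_spectrum 3 12"
  by (rule lcf_spectrum[of 7
      "[-17, -71, -11, 43, 11, 33, 91, -43, 71, 17, 79, -79, -33, -17, -71, -11, 43, 11, 33, 91,
        -43, 71, 17, 79, -79, -33]" _
      "[1, 2, 3, 174, 175, 176, 177, 178, 179, 180, 181, 182]"],
    simp, simp add: expand_simps, simp only: check_simps cong: if_weak_cong)

lemma order_192: "192 \<in> kg_spectrum 3 12"
  by (rule lcf_spectrum[of 32
      "[33, 75, -51, -33, -75, 51]" _
      "[1, 2, 77, 76, 43, 42, 41, 158, 157, 190, 191, 192]"],
    simp, simp add: expand_simps, simp only: check_simps cong: if_weak_cong)

lemma order_204: "204 \<in> kg_spectrum 3 12"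
  by (rule lcf_spectrum[of 34
      "[-89, 89, -71, 71, -53, 53]" _
      "[1, 2, 3, 136, 137, 84, 85, 200, 201, 202, 203, 204]"],
    simp, simp add: expand_simps, simp only: check_simps cong: if_weak_cong)

lemma order_206: "206 \<in> kg_spectrum 3 12"
  by (rule lcf_spectrum[of 1
      "[-29, -11, -97, 57, 19, 99, 47, -59, 63, -69, -37, -91, 27, 97, 65, 75, -21, 27, 37, 45,
        -101, -93, 95, -19, -89, -71, -33, -63, 35, 85, 59, -59, 43, 73, -55, -41, 49, -69, 19,
        -27, -95, 99, -61, 29, -27, 75, 59, 97, -91, -51, 77, -73, 85, -47, -93, -37, 103, -19,
        35, 17, -57, -79, 83, -35, -45, 43, 73, -97, 97, 25, 43, -63, -29, 27, 61, -43, -17, 45,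
        91, -65, 23, 77, 33, 55, 63, -49, 37, 77, 65, -59, -75, 51, 37, -35, -25, 103, 23, 51, 11,
        63, -27, 91, 73, -23, -99, -59, -73, 23, -43, -11, -97, 97, 71, -43, -85, -33, 87, -95,
        55, -23, -75, 61, -45, -37, 69, 101, 91, -77, 43, -37, -23, 59, 49, 19, 93, -61, 61, -85,
        -55, -73, -99, 89, -51, 51, -97, -83, 69, -63, -51, 19, 55, 95, -19, -65, 59, 17, 39, 29,
        -77, 103, 71, 19, -63, 91, -77, -97, 23, 93, -19, -91, 63, -43, -17, -55, 69, -73, 97, 29,
        59, 37, -19, -49, -61, -71, 73, 55, -29, 61, 79, -23, -59, 11, -91, -69, -51, -39, 11,
        -61, 103, 33, 41, 21, -11, -87, 51, -55]" _
      "[1, 2, 197, 198, 199, 200, 201, 202, 203, 204, 205, 206]"],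
    simp, simp add: expand_simps, simp only: check_simps cong: if_weak_cong)

lemma order_208: "208 \<in> kg_spectrum 3 12"
  by (rule lcf_spectrum[of 13
      "[33, -33, -55, -93, -21, 67, 93, -13, -67, -43, 13, 55, 97, -97, 43, 21]" _
      "[1, 2, 3, 156, 155, 154, 111, 110, 109, 206, 207, 208]"],
    simp, simp add: expand_simps, simp only: check_simps cong: if_weak_cong)

lemma order_210: "210 \<in> kg_spectrum 3 12"
  by (rule lcf_spectrum[of 35
      "[-45, 99, -75, 45, -99, 75]" _
      "[1, 2, 3, 138, 139, 94, 95, 206, 207, 208, 209, 210]"],
    simp, simp add: expand_simps, simp only: check_simps cong: if_weak_cong)

lemma order_212: "212 \<in> kg_spectrum 3 12"
  by (rule lcf_spectrum[of 1
      "[-81, 69, -37, 53, 79, 29, -19, 83, -71, -63, -51, 47, -83, 81, 105, -51, -33, 45, -71,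
        -43, -95, 17, 63, -87, 97, 35, 71, 81, 61, -49, -79, -97, 31, 101, -29, 89, 65, -83, -17,
        91, 25, -73, 51, -99, -55, -93, 13, 89, 33, -87, 49, 13, -61, 97, -99, -83, -53, 55, -47,
        -13, -35, 11, -45, -31, -13, -25, 43, 51, 101, 69, -69, 21, -11, 79, 99, -87, 35, 83, 17,
        89, 65, -33, 25, -79, 71, -63, -93, 27, 87, -61, -83, 95, -21, -51, -81, -17, 37, -71, 99,
        -49, 57, -65, 11, 87, 75, 35, 21, -25, -81, -43, 99, -35, -55, -11, -27, 17, 35, 45, -51,
        -105, 63, -97, 89, 49, -89, 79, 35, -21, 57, 65, -91, 81, -17, -37, -101, 47, -89, 95,
        -69, 59, -35, 83, 11, 67, 43, -65, 97, 31, 87, 71, -97, -35, -79, -11, 39, -71, 99, -57,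
        63, 71, -83, -35, -45, 79, 93, 43, 83, 99, -89, -101, 21, 51, -49, -99, 87, -87, 51, 37,
        -31, -75, 73, 25, -47, -63, 83, -57, -95, -43, 43, 13, -87, -21, 49, -39, -65, 33, 11,
        -99, -59, 19, 87, 55, -13, 61, -79, 93, -25, -11, -43, -99, -67, -89]" _
      "[1, 2, 3, 4, 57, 58, 113, 112, 111, 210, 211, 212]"],
    simp, simp add: expand_simps, simp only: check_simps cong: if_weak_cong)

lemma order_214: "214 \<in> kg_spectrum 3 12"
  by (rule lcf_spectrum[of 1
      "[21, 103, -61, 63, -93, 73, -71, -105, 19, -55, 51, -71, -17, 41, 75, -37, 21, -71, -57,
        -85, 51, -21, 107, 23, -53, 13, -43, -19, 23, -69, 97, -63, 11, -97, -47, -37, 75, -21,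
        -13, 83, 103, -47, 25, -11, 15, 47, -23, -91, -71, 27, 35, -23, 43, -65, -41, 75, 63, 25,
        79, -15, 101, -51, 83, -91, -75, -103, -63, -25, 41, -85, -95, -51, 51, -83, 107, 25, -27,
        55, -73, -83, 107, 91, -25, 29, 63, -35, 77, 97, 51, -75, 11, 23, -47, 31, 13, -43, 63,
        91, 53, 67, -25, -11, 71, 41, -103, 13, 77, -13, 25, -41, 57, -75, -29, 43, -23, 91, 105,
        73, -13, -63, 57, 31, -83, -51, -31, 93, 67, -97, 37, 107, -75, 11, -55, -25, 19, 59, 69,
        -79, 75, -51, 29, 17, -11, -103, -41, -83, 49, -63, 85, 71, 97, -53, -31, -19, 71, 61,
        -43, 23, -17, -63, 71, -101, 37, -77, 43, -37, -67, -57, 55, -29, 91, 29, -91, -71, 69,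
        57, 103, -57, 33, 17, -23, 107, 63, -77, -97, 53, 91, 107, -91, 95, -73, 71, 37, -67, -59,
        -49, -17, 43, 85, -37, -29, 47, 65, 75, 83, -69, -91, -43, 47, 17, 83, -33, 37, -75]" _
      "[1, 2, 3, 156, 155, 12, 13, 210, 211, 212, 213, 214]"],
    simp, simp add: expand_simps, simp only: check_simps cong: if_weak_cong)

lemma order_216: "216 \<in> kg_spectrum 3 12"
  by (rule lcf_spectrum[of 36
      "[33, -51, -75, -33, 51, 75]" _
      "[1, 2, 167, 168, 27, 28, 211, 212, 213, 214, 215, 216]"],
    simp, simp add: expand_simps, simp only: check_simps cong: if_weak_cong)

lemma order_218: "218 \<in> kg_spectrum 3 12"
  by (rule lcf_spectrum[of 1
      "[83, 73, -81, -97, 51, 11, 99, -65, 31, -11, -37, 15, -81, 49, -97, -37, -11, 71, -59, -85,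
        89, -39, 73, 99, 79, 105, -15, 25, 57, -41, 107, -71, 45, -103, 13, 33, 87, 49, 73, -31,
        -85, 31, 59, 11, -97, 69, -47, -13, -95, 41, 91, 107, -25, 13, -11, -51, 91, 37, -83, 25,
        101, -99, -49, 109, 43, -69, -13, -97, -33, -89, 59, 83, -31, -87, -73, 21, 83, -45, -83,
        33, 89, 23, 105, -83, -25, -57, -49, 79, -71, 101, -41, 91, -99, 43, -37, -73, -21, 19,
        91, 27, 79, -59, 41, -79, -23, -99, 99, -43, 19, -89, 73, -73, -33, 81, -69, 17, -19, 33,
        89, 49, 61, 35, -99, -87, 97, 85, -27, -19, 39, -59, -105, 45, -17, 69, 23, 97, -43, -107,
        25, 81, 11, -91, 53, -41, 71, 39, 57, -91, 103, 81, -33, -11, 85, 59, -83, 37, -35, -23,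
        -107, -83, 65, -101, 37, -25, 21, 97, -79, -39, -49, -89, 31, 95, 109, 85, 35, 11, -45,
        59, 71, -79, 99, -61, -91, -73, -39, -21, -11, -105, 97, -91, -101, 37, -37, 83, -81, -53,
        37, 11, 89, -37, 39, -31, -69, -57, 87, -99, 41, -89, -11, -35, -85, 99, -59, 83, 69, -71,
        11, 47]" _
      "[1, 2, 75, 76, 77, 78, 79, 214, 215, 216, 217, 218]"],
    simp, simp add: expand_simps, simp only: check_simps cong: if_weak_cong)

lemma order_220: "220 \<in> kg_spectrum 3 12"
  by (rule lcf_spectrum[of 22
      "[33, 85, 15, -33, 61, -61, -85, -15, 81, -81]" _
      "[1, 2, 87, 88, 89, 170, 171, 204, 203, 218, 219, 220]"],
    simp, simp add: expand_simps, simp only: check_simps cong: if_weak_cong)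

lemma order_222: "222 \<in> kg_spectrum 3 12"
  by (rule lcf_spectrum[of 37
      "[95, -11, 11, 55, -55, -95]" _
      "[1, 2, 213, 214, 215, 216, 217, 218, 219, 220, 221, 222]"],
    simp, simp add: expand_simps, simp only: check_simps cong: if_weak_cong)

lemma order_224: "224 \<in> kg_spectrum 3 12"
  by (rule lcf_spectrum[of 28
      "[-61, 11, -43, 61, -11, 81, -81, 43]" _
      "[1, 2, 3, 4, 5, 218, 219, 220, 221, 222, 223, 224]"],
    simp, simp add: expand_simps, simp only: check_simps cong: if_weak_cong)

lemma order_226: "226 \<in> kg_spectrum 3 12"
  by (rule lcf_spectrum[of 1
      "[25, 33, -79, 15, -89, 75, 43, -29, -55, -47, 101, 85, 73, -45, -109, 13, -59, 101, -15,
        51, -81, 31, 67, -47, 79, -25, 31, -85, -13, -35, 79, -49, 45, -73, -33, 95, 17, 25, -59,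
        107, 29, 61, -111, -91, 15, 41, -87, -57, 17, -43, -53, 101, -31, -17, -99, 85, -91, -31,
        55, -15, -87, 45, -25, 35, 103, -17, 25, 45, 55, -29, -51, -107, -81, 59, 31, 105, 69,
        -45, 19, 79, -75, -95, 89, 33, -85, -73, -41, 51, 59, -67, 69, -25, -109, 49, 33, -103,
        -85, -19, -35, 37, 15, 95, -61, -79, 69, -31, -45, 55, 31, -79, 45, -101, -45, -55, 15,
        -15, -33, 89, -101, 37, 95, 53, 15, -55, 27, 59, 77, -33, 35, -15, -95, 109, -59, 21, 67,
        75, -37, -15, -51, -31, -85, 89, -49, 55, 25, -69, -107, -59, 71, 79, 45, -27, -101, 17,
        -21, -45, -37, 111, -79, -69, 29, 63, -55, -35, 49, 81, 11, -103, 85, -25, -17, -89, 15,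
        -69, -53, 47, 17, -11, 91, 55, -105, 99, 29, 59, -59, 87, 73, -15, 47, -29, 107, 91, 15,
        -17, 45, -45, -95, 17, -55, 87, 21, -67, 47, -77, 29, 59, -89, -15, 49, 109, -75, -29, 95,
        -49, -17, -95, 57, 81, 103, -71, 35, -21, -47, 53, -63, 85]" _
      "[1, 2, 3, 150, 149, 220, 221, 222, 223, 224, 225, 226]"],
    simp, simp add: expand_simps, simp only: check_simps cong: if_weak_cong)

lemma order_228: "228 \<in> kg_spectrum 3 12"
  by (rule lcf_spectrum[of 38
      "[33, 75, -21, -33, -75, 21]" _
      "[1, 2, 77, 76, 43, 42, 41, 194, 193, 226, 227, 228]"],
    simp, simp add: expand_simps, simp only: check_simps cong: if_weak_cong)

lemma order_230: "230 \<in> kg_spectrum 3 12"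
  by (rule lcf_spectrum[of 23
      "[95, 85, -99, 99, 23, -95, -85, -23, 81, -81]" _
      "[1, 2, 3, 134, 133, 132, 131, 226, 227, 228, 229, 230]"],
    simp, simp add: expand_simps, simp only: check_simps cong: if_weak_cong)

lemma order_232: "232 \<in> kg_spectrum 3 12"
  by (rule lcf_spectrum[of 29
      "[33, -33, 19, 67, -77, -19, -67, 77]" _
      "[1, 2, 201, 200, 45, 46, 47, 212, 211, 230, 231, 232]"],
    simp, simp add: expand_simps, simp only: check_simps cong: if_weak_cong)

lemma order_234: "234 \<in> kg_spectrum 3 12"
  by (rule lcf_spectrum[of 39
      "[95, 19, -19, 61, -61, -95]" _
      "[1, 2, 3, 218, 219, 200, 199, 60, 59, 232, 233, 234]"],
    simp, simp add: expand_simps, simp only: check_simps cong: if_weak_cong)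

lemma order_236: "236 \<in> kg_spectrum 3 12"
  by (rule lcf_spectrum[of 1
      "[-15, -33, -117, -73, 93, -55, 71, 83, -99, 47, 59, 117, -109, 103, 37, 27, -33, 57, 89,
        -57, -99, -77, -23, -47, 23, -115, 35, 57, -99, 39, -57, 87, -71, 47, -101, 37, -59, -47,
        47, 71, 85, 61, -27, -115, -85, -57, 87, -23, 105, 17, 31, -37, -81, 45, -57, 107, -47,
        49, -71, 55, 63, -35, 11, -111, 115, -73, -17, 105, -39, -59, -103, 29, -37, -11, -57, 77,
        -81, -71, 81, 33, -47, -31, 23, 101, -57, -47, 107, 67, 27, 81, -83, 117, 43, -109, -101,
        101, 31, -93, -45, 57, -29, 41, -61, -109, 107, -23, -49, -89, 59, 23, -71, 67, -33, 89,
        -55, -27, -103, 65, -87, 25, 107, 117, 15, -63, 49, -85, 25, -31, -117, 61, 87, 101, -23,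
        -87, 49, -43, 25, -15, 61, 109, 37, 81, -41, 49, -25, 99, 115, 71, 53, 19, 31, -25, -77,
        -105, -67, 61, -57, 99, 67, -81, 31, -25, -107, 51, 115, 99, 73, -59, -19, 101, -81, 63,
        -105, -49, 11, 31, 39, -37, -67, -115, 77, -31, -65, -49, -101, -11, 55, 13, 111, 21, -61,
        -31, -49, -107, 11, 85, -101, 71, 57, -61, -13, -53, -89, 103, 33, -11, -31, 81, -117, 57,
        -21, -107, 47, 59, -51, -39, -61, -87, -71, 33, 109, 15, -81, 71, 57, -67, 47, -107, 73,
        101, 109, 81, -101, 57, -63, 23]" _
      "[1, 2, 205, 206, 207, 208, 53, 54, 55, 234, 235, 236]"],
    simp, simp add: expand_simps, simp only: check_simps cong: if_weak_cong)

lemma order_238: "238 \<in> kg_spectrum 3 12"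
  by (rule lcf_spectrum[of 17
      "[95, 25, 75, -51, -65, -23, -35, -75, 51, 65, 23, -95, -25, 35]" _
      "[1, 2, 27, 28, 63, 62, 61, 234, 235, 236, 237, 238]"],
    simp, simp add: expand_simps, simp only: check_simps cong: if_weak_cong)

lemma order_240: "240 \<in> kg_spectrum 3 12"
  by (rule lcf_spectrum[of 40
      "[33, 75, 51, -33, -75, -51]" _
      "[1, 2, 77, 78, 27, 28, 235, 236, 237, 238, 239, 240]"],
    simp, simp add: expand_simps, simp only: check_simps cong: if_weak_cong)

lemma order_242: "242 \<in> kg_spectrum 3 12"
  by (rule lcf_spectrum[of 11
      "[95, -79, -95, -65, 65, -41, 95, -95, 41, 121, 79, 95, -79, -95, -65, 65, -41, 95, -95, 41,
        121, 79]" _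
      "[1, 2, 165, 164, 43, 42, 41, 40, 39, 240, 241, 242]"],
    simp, simp add: expand_simps, simp only: check_simps cong: if_weak_cong)

lemma order_244: "244 \<in> kg_spectrum 3 12"
  by (rule lcf_spectrum[of 1
      "[-81, -29, 79, -67, -43, 103, 19, -23, 81, 119, 33, -17, -69, -39, -91, -105, -31, 117,
        -119, -23, 85, -105, -33, -75, 91, -19, -85, 105, -99, 43, -115, -71, 85, 119, 91, 107,
        -61, 73, 119, 53, 93, -87, 27, -33, 69, 35, -81, 89, 59, 99, -111, 113, -69, 59, 77, -85,
        -61, 37, -81, -95, 115, -117, 49, -65, 55, -75, 89, 73, -97, -27, 79, -85, -43, -97, 117,
        107, -83, 21, 63, 89, -35, -79, 111, 47, 17, 73, 37, -109, -89, -81, 121, 55, -53, 27,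
        -37, 67, 31, 99, -21, 107, 47, -17, 75, 15, 113, -85, 91, -59, -103, 61, -73, -49, -59,
        -69, 31, -91, 107, -85, -15, -55, -27, 63, 47, -37, 107, -91, 53, -31, -119, 73, -47, -77,
        -105, -93, -117, 43, -89, 87, 23, 47, -73, -63, -107, 119, 57, -31, -55, -47, -99, -79,
        91, 43, -119, 57, 105, -89, 25, -119, -73, 115, 105, -23, -67, 81, -113, 11, 37, 91, -89,
        -47, -61, 41, 63, 99, 21, -115, -11, -75, -43, -53, 67, -25, -107, 111, -63, 85, -47, 69,
        117, 11, 23, -117, 75, -111, -43, -21, -99, -91, 87, 27, -11, -57, -73, -37, 71, 43, -107,
        25, 95, 81, -57, -121, -41, -23, 85, 97, 29, -113, 39, 61, 97, 81, 109, -107, -87, 11,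
        -27, 69, 23, 31, 85, -107, -25, 33, 75, -63, -11, 83, 17, 61, 23, -91, 65, 89]" _
      "[1, 2, 217, 216, 215, 56, 57, 240, 241, 242, 243, 244]"],
    simp, simp add: expand_simps, simp only: check_simps cong: if_weak_cong)

lemma order_246: "246 \<in> kg_spectrum 3 12"
  by (rule lcf_spectrum[of 41
      "[95, 19, -19, -65, 65, -95]" _
      "[1, 2, 21, 20, 19, 114, 113, 178, 179, 244, 245, 246]"],
    simp, simp add: expand_simps, simp only: check_simps cong: if_weak_cong)

lemma order_248: "248 \<in> kg_spectrum 3 12"
  by (rule lcf_spectrum[of 31
      "[33, -33, 19, 91, -45, -19, -91, 45]" _
      "[1, 2, 217, 216, 13, 14, 243, 244, 245, 246, 247, 248]"],
    simp, simp add: expand_simps, simp only: check_simps cong: if_weak_cong)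

lemma order_250: "250 \<in> kg_spectrum 3 12"
  by (rule lcf_spectrum[of 25
      "[95, -45, 21, -21, -57, -95, 45, 57, 121, -121]" _
      "[1, 2, 3, 24, 23, 44, 43, 42, 247, 248, 249, 250]"],
    simp, simp add: expand_simps, simp only: check_simps cong: if_weak_cong)

lemma order_254: "254 \<in> kg_spectrum 3 12"
  by (rule lcf_spectrum[of 1
      "[127, 17, 67, -43, -13, 117, -85, -29, 85, -13, -65, 127, 87, 33, -81, -121, -49, 67, -17,
        17, 31, 121, -29, -85, 21, 61, -63, 37, 87, 63, 19, 127, 27, -49, 85, 63, -17, -63, -115,
        17, -43, 61, -89, 67, -117, -21, -33, -89, 85, -19, 115, -31, -109, -119, 117, -65, -17,
        -109, 67, -27, 81, 119, -85, 37, -37, 85, -119, -81, 27, -67, 109, 17, 65, -117, 119, 109,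
        31, -115, 19, -85, 89, 33, 21, 117, -67, 89, -61, 43, -17, 115, 63, 17, -63, -85, 49, -27,
        127, -19, -63, -87, -37, 63, -61, -21, 85, 29, -121, -31, -17, 17, -67, 49, 121, 81, -33,
        -87, 127, 65, 13, -85, 29, 85, -117, 13, 43, -67, -17, 127, 17, 67, -43, -13, 117, -85,
        -29, 85, -13, -65, 127, 87, 33, -81, -121, -49, 67, -17, 17, 31, 121, -29, -85, 21, 61,
        -63, 37, 87, 63, 19, 127, 27, -49, 85, 63, -17, -63, -115, 17, -43, 61, -89, 67, -117,
        -21, -33, -89, 85, -19, 115, -31, -109, -119, 117, -65, -17, -109, 67, -27, 81, 119, -85,
        37, -37, 85, -119, -81, 27, -67, 109, 17, 65, -117, 119, 109, 31, -115, 19, -85, 89, 33,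
        21, 117, -67, 89, -61, 43, -17, 115, 63, 17, -63, -85, 49, -27, 127, -19, -63, -87, -37,
        63, -61, -21, 85, 29, -121, -31, -17, 17, -67, 49, 121, 81, -33, -87, 127, 65, 13, -85,
        29, 85, -117, 13, 43, -67, -17]" _
      "[1, 2, 19, 20, 37, 38, 39, 40, 41, 252, 253, 254]"],
    simp, simp add: expand_simps, simp only: check_simps cong: if_weak_cong)

lemma order_256: "256 \<in> kg_spectrum 3 12"
  by (rule lcf_spectrum[of 32
      "[33, -33, -13, -93, 115, 13, 93, -115]" _
      "[1, 2, 225, 224, 109, 110, 111, 112, 253, 254, 255, 256]"],
    simp, simp add: expand_simps, simp only: check_simps cong: if_weak_cong)

lemma order_258: "258 \<in> kg_spectrum 3 12"
  by (rule lcf_spectrum[of 43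
      "[95, -41, 41, -11, 11, -95]" _
      "[1, 2, 3, 4, 251, 252, 253, 254, 255, 256, 257, 258]"],
    simp, simp add: expand_simps, simp only: check_simps cong: if_weak_cong)

lemma order_260: "260 \<in> kg_spectrum 3 12"
  by (rule lcf_spectrum[of 26
      "[33, -85, 23, -33, 35, -23, 85, -99, 99, -35]" _
      "[1, 2, 3, 4, 231, 232, 233, 256, 257, 258, 259, 260]"],
    simp, simp add: expand_simps, simp only: check_simps cong: if_weak_cong)

lemma order_262: "262 \<in> kg_spectrum 3 12"
  by (rule lcf_spectrum[of 1
      "[131, -11, 55, -29, -67, -85, 83, -79, 45, -105, -11, 91, 31, 131, -51, -115, 11, 37, 81,
        131, -111, 55, -103, 21, 131, 11, -29, -11, -97, 91, 41, 115, 81, -79, -99, 105, -11, -51,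
        55, 45, 111, 29, 83, -31, -21, 11, -79, 45, 25, -113, 103, 85, 27, -45, -37, 55, -11, -55,
        25, 79, 41, 29, 97, -67, -113, -99, 99, 113, 67, -97, -29, -41, -79, -25, 55, 11, -55, 37,
        45, -27, -85, -103, 113, -25, -45, 79, -11, 21, 31, -83, -29, -111, -45, -55, 51, 11,
        -105, 99, 79, -81, -115, -41, -91, 97, 11, 29, -11, 131, -21, 103, -55, 111, 131, -81,
        -37, -11, 115, 51, 131, -31, -91, 11, 105, -45, 79, -83, 85, 67, 29, -55, 11, 131, -11,
        55, -29, -67, -85, 83, -79, 45, -105, -11, 91, 31, 131, -51, -115, 11, 37, 81, 131, -111,
        55, -103, 21, 131, 11, -29, -11, -97, 91, 41, 115, 81, -79, -99, 105, -11, -51, 55, 45,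
        111, 29, 83, -31, -21, 11, -79, 45, 25, -113, 103, 85, 27, -45, -37, 55, -11, -55, 25, 79,
        41, 29, 97, -67, -113, -99, 99, 113, 67, -97, -29, -41, -79, -25, 55, 11, -55, 37, 45,
        -27, -85, -103, 113, -25, -45, 79, -11, 21, 31, -83, -29, -111, -45, -55, 51, 11, -105,
        99, 79, -81, -115, -41, -91, 97, 11, 29, -11, 131, -21, 103, -55, 111, 131, -81, -37, -11,
        115, 51, 131, -31, -91, 11, 105, -45, 79, -83, 85, 67, 29, -55, 11]" _
      "[1, 2, 253, 254, 255, 256, 257, 258, 259, 260, 261, 262]"],
    simp, simp add: expand_simps, simp only: check_simps cong: if_weak_cong)

lemma order_264: "264 \<in> kg_spectrum 3 12"
  by (rule lcf_spectrum[of 44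
      "[33, -45, -99, -33, 45, 99]" _
      "[1, 2, 221, 220, 187, 186, 185, 230, 229, 262, 263, 264]"],
    simp, simp add: expand_simps, simp only: check_simps cong: if_weak_cong)

lemma order_266: "266 \<in> kg_spectrum 3 12"
  by (rule lcf_spectrum[of 19
      "[19, 93, -31, -93, 133, -19, 31, 19, 93, -31, -93, 133, -19, 31]" _
      "[1, 2, 95, 96, 229, 230, 231, 262, 263, 264, 265, 266]"],
    simp, simp add: expand_simps, simp only: check_simps cong: if_weak_cong)

lemma order_268: "268 \<in> kg_spectrum 3 12"
  by (rule lcf_spectrum[of 2
      "[31, -31, 79, -67, 33, 69, -31, -65, -25, -17, -93, -129, -55, 109, 91, 65, 129, 23, -25,
        13, -125, -117, -71, -45, -111, 77, -31, 65, 49, 125, 91, -31, -13, 77, 55, -109, 17, -33,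
        117, 29, -23, -111, -93, 65, -55, 27, 55, 111, -113, -127, -71, 93, -93, -17, 79, 65, 127,
        -113, 49, -65, 109, 69, 11, 27, 111, -67, -113, 29, -29, 113, 67, -111, -27, -11, -69,
        -109, 65, -49, 113, -127, -65, -79, 17, 93, -93, 71, 127, 113, -111, -55, -27, 55, -65,
        93, 111, 23, -29, -117, 33, -17, 109, -55, -77, 13, 31, -91, -125, -49, -65, 31, -77, 111,
        45, 71, 117, 125, -13, 25, -23, -129, -65, -91, -109, 55, 129, 93, 17, 25, 65, 31, -69,
        -33, 67, -79]" _
      "[1, 2, 239, 238, 237, 236, 235, 234, 233, 266, 267, 268]"],
    simp, simp add: expand_simps, simp only: check_simps cong: if_weak_cong)

lemma order_270: "270 \<in> kg_spectrum 3 12"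
  by (rule lcf_spectrum[of 45
      "[-13, 49, -49, -71, 71, 13]" _
      "[1, 2, 51, 52, 251, 252, 265, 266, 267, 268, 269, 270]"],
    simp, simp add: expand_simps, simp only: check_simps cong: if_weak_cong)

lemma order_272: "272 \<in> kg_spectrum 3 12"
  by (rule lcf_spectrum[of 34
      "[-17, 75, 131, -101, -75, -131, 101, 17]" _
      "[1, 2, 3, 4, 175, 176, 193, 194, 269, 270, 271, 272]"],
    simp, simp add: expand_simps, simp only: check_simps cong: if_weak_cong)

lemma order_274: "274 \<in> kg_spectrum 3 12"
  by (rule lcf_spectrum[of 1
      "[137, 101, -23, 63, 83, 51, 125, -91, -121, 109, 81, 59, -115, -39, 83, 45, 91, 19, -113,
        109, 69, -23, -61, 137, 121, 43, -39, -105, -93, 79, 91, 137, 23, 59, 115, 101, -19, -117,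
        -99, -61, 83, 11, 113, 51, -127, 59, 81, -109, 69, 137, 83, 13, -11, 91, 127, -23, -51,
        117, -121, 105, -45, -99, -109, -121, -13, -93, -63, 59, -43, 43, -59, 63, 93, 13, 121,
        109, 99, 45, -105, 121, -117, 51, 23, -127, -91, 11, -13, -83, 137, -69, 109, -81, -59,
        127, -51, -113, -11, -83, 61, 99, 117, 19, -101, -115, -59, -23, 137, -91, -79, 93, 105,
        39, -43, -121, 137, 61, 23, -69, -109, 113, -19, -91, -45, -83, 39, 115, -59, -81, -109,
        121, 91, -125, -51, -83, -63, 23, -101, 137, 101, -23, 63, 83, 51, 125, -91, -121, 109,
        81, 59, -115, -39, 83, 45, 91, 19, -113, 109, 69, -23, -61, 137, 121, 43, -39, -105, -93,
        79, 91, 137, 23, 59, 115, 101, -19, -117, -99, -61, 83, 11, 113, 51, -127, 59, 81, -109,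
        69, 137, 83, 13, -11, 91, 127, -23, -51, 117, -121, 105, -45, -99, -109, -121, -13, -93,
        -63, 59, -43, 43, -59, 63, 93, 13, 121, 109, 99, 45, -105, 121, -117, 51, 23, -127, -91,
        11, -13, -83, 137, -69, 109, -81, -59, 127, -51, -113, -11, -83, 61, 99, 117, 19, -101,
        -115, -59, -23, 137, -91, -79, 93, 105, 39, -43, -121, 137, 61, 23, -69, -109, 113, -19,
        -91, -45, -83, 39, 115, -59, -81, -109, 121, 91, -125, -51, -83, -63, 23, -101]" _
      "[1, 2, 103, 102, 101, 218, 219, 270, 271, 272, 273, 274]"],
    simp, simp add: expand_simps, simp only: check_simps cong: if_weak_cong)

lemma order_276: "276 \<in> kg_spectrum 3 12"
  by (rule lcf_spectrum[of 46
      "[-21, -87, 33, 21, 87, -33]" _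
      "[1, 2, 191, 190, 211, 210, 209, 20, 19, 274, 275, 276]"],
    simp, simp add: expand_simps, simp only: check_simps cong: if_weak_cong)

lemma order_278: "278 \<in> kg_spectrum 3 12"
  by (rule lcf_spectrum[of 1
      "[139, 107, 79, -47, -67, 13, 127, 59, 85, -29, 15, 117, 29, 39, -73, -111, -87, 11, -13,
        -101, -29, 81, 139, -111, -69, -15, -103, 139, -11, 49, -133, 107, -81, -71, 63, -105,
        133, 81, -71, -123, 35, -29, 63, 111, -47, -69, 85, -119, -101, -81, 29, 111, -39, -101,
        11, 123, 139, 101, 79, -73, 29, 49, 103, -67, 35, -11, -59, 119, 87, 105, -105, -87, -119,
        59, 11, -35, 67, -103, -49, -29, 73, -79, -101, 139, -123, -11, 101, 39, -111, -29, 81,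
        101, 119, -85, 69, 47, -111, -63, 29, -35, 123, 71, -81, -133, 105, -63, 71, 81, -107,
        133, -49, 11, 139, 103, 15, 69, 111, 139, -81, 29, 101, 13, -11, 87, 111, 73, -39, -29,
        -117, -15, 29, -85, -59, -127, -13, 67, 47, -79, -107, 139, 107, 79, -47, -67, 13, 127,
        59, 85, -29, 15, 117, 29, 39, -73, -111, -87, 11, -13, -101, -29, 81, 139, -111, -69, -15,
        -103, 139, -11, 49, -133, 107, -81, -71, 63, -105, 133, 81, -71, -123, 35, -29, 63, 111,
        -47, -69, 85, -119, -101, -81, 29, 111, -39, -101, 11, 123, 139, 101, 79, -73, 29, 49,
        103, -67, 35, -11, -59, 119, 87, 105, -105, -87, -119, 59, 11, -35, 67, -103, -49, -29,
        73, -79, -101, 139, -123, -11, 101, 39, -111, -29, 81, 101, 119, -85, 69, 47, -111, -63,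
        29, -35, 123, 71, -81, -133, 105, -63, 71, 81, -107, 133, -49, 11, 139, 103, 15, 69, 111,
        139, -81, 29, 101, 13, -11, 87, 111, 73, -39, -29, -117, -15, 29, -85, -59, -127, -13, 67,
        47, -79, -107]" _
      "[1, 2, 3, 82, 83, 260, 261, 274, 275, 276, 277, 278]"],
    simp, simp add: expand_simps, simp only: check_simps cong: if_weak_cong)

lemma order_280: "280 \<in> kg_spectrum 3 12"
  by (rule lcf_spectrum[of 35
      "[-25, -103, 103, 41, -41, 89, -89, 25]" _
      "[1, 2, 3, 4, 45, 44, 85, 86, 87, 278, 279, 280]"],
    simp, simp add: expand_simps, simp only: check_simps cong: if_weak_cong)

lemma order_282: "282 \<in> kg_spectrum 3 12"
  by (rule lcf_spectrum[of 47
      "[-25, 97, -97, -113, 113, 25]" _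
      "[1, 2, 3, 188, 189, 92, 93, 278, 279, 280, 281, 282]"],
    simp, simp add: expand_simps, simp only: check_simps cong: if_weak_cong)

lemma order_284: "284 \<in> kg_spectrum 3 12"
  by (rule lcf_spectrum[of 2
      "[-29, 29, 119, 107, 93, -137, -129, -13, 95, -65, 137, 105, 61, -25, -107, 107, 31, 73,
        -137, 129, 57, 107, 119, 137, -129, -49, -67, 105, 51, 27, -29, -99, -115, 107, 27, -79,
        35, 129, -95, 15, 95, 51, -67, 57, 31, -79, 93, -31, -135, 107, 13, 51, 31, 73, -15, 135,
        -27, -65, -95, 115, 31, -27, -123, -13, 51, 13, 57, -133, 31, -99, 61, -35, 35, -61, 99,
        -31, 133, -57, -13, -51, 13, 123, 27, -31, -115, 95, 65, 27, -135, 15, -73, -31, -51, -13,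
        -107, 135, 31, -93, 79, -31, -57, 67, -51, -95, -15, 95, -129, -35, 79, -27, -107, 115,
        99, 29, -27, -51, -105, 67, 49, 129, -137, -119, -107, -57, -129, 137, -73, -31, -107,
        107, 25, -61, -105, -137, 65, -95, 13, 129, 137, -93, -107, -119]" _
      "[1, 2, 3, 122, 123, 124, 125, 280, 281, 282, 283, 284]"],
    simp, simp add: expand_simps, simp only: check_simps cong: if_weak_cong)

lemma order_286: "286 \<in> kg_spectrum 3 12"
  by (rule lcf_spectrum[of 13
      "[-29, 133, -133, 47, 29, 37, -47, 143, -97, -37, 97, -29, 133, -133, 47, 29, 37, -47, 143,
        -97, -37, 97]" _
      "[1, 2, 135, 136, 137, 138, 139, 140, 283, 284, 285, 286]"],
    simp, simp add: expand_simps, simp only: check_simps cong: if_weak_cong)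

lemma order_290: "290 \<in> kg_spectrum 3 12"
  by (rule lcf_spectrum[of 29
      "[-33, -13, -109, 109, -139, 139, -67, 33, 13, 67]" _
      "[1, 2, 279, 278, 21, 20, 19, 32, 31, 288, 289, 290]"],
    simp, simp add: expand_simps, simp only: check_simps cong: if_weak_cong)

lemma order_292: "292 \<in> kg_spectrum 3 12"
  by (rule lcf_spectrum[of 2
      "[-37, 37, -141, 101, 11, -73, -25, 141, -101, 107, 75, 33, 13, 55, 83, -11, -133, -93, 103,
        65, -25, -71, 79, -57, -109, -13, 103, 29, 79, 133, 63, 107, 83, -91, -109, -57, 63, 35,
        -37, 21, 79, -89, -131, 101, -33, -99, 79, 53, 63, -89, 83, -71, 15, 101, 63, -99, -29,
        131, 25, -91, -21, 109, 75, 65, 25, -129, -139, -15, -55, -73, 93, 109, -35, 139, -139,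
        35, -109, -93, 73, 55, 15, 139, 129, -25, -65, -75, -109, 21, 91, -25, -131, 29, 99, -63,
        -101, -15, 71, -83, 89, -63, -53, -79, 99, 33, -101, 131, 89, -79, -21, 37, -35, -63, 57,
        109, 91, -83, -107, -63, -133, -79, -29, -103, 13, 109, 57, -79, 71, 25, -65, -103, 93,
        133, 11, -83, -55, -13, -33, -75, -107, 101, -141, 25, 73, -11, -101, 141]" _
      "[1, 2, 39, 38, 73, 72, 71, 70, 289, 290, 291, 292]"],
    simp, simp add: expand_simps, simp only: check_simps cong: if_weak_cong)

lemma order_296: "296 \<in> kg_spectrum 3 12"
  by (rule lcf_spectrum[of 37
      "[-41, 19, -69, 131, -19, 69, -131, 41]" _
      "[1, 2, 3, 230, 231, 232, 273, 274, 293, 294, 295, 296]"],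
    simp, simp add: expand_simps, simp only: check_simps cong: if_weak_cong)

lemma order_298: "298 \<in> kg_spectrum 3 12"
  by (rule lcf_spectrum[of 1
      "[83, -125, 127, -43, 111, 65, -19, 35, -119, -37, 51, 15, 23, -55, 67, 31, -35, -139, 115,
        13, 47, -131, -111, -75, 61, 125, -15, 139, -35, 49, 87, -89, -13, 63, -57, -23, 39, 91,
        119, 131, 71, -47, -35, 81, -79, 101, -31, 59, -131, -121, -113, 71, 61, 23, -109, -135,
        -123, 31, 81, 57, 111, -51, -109, -133, -79, 45, 131, -47, 149, 135, -65, -117, 63, -103,
        -91, -39, -23, 121, -49, 133, 149, -67, 123, -83, 39, -61, 113, -99, -31, 11, 149, 89,
        -133, 55, 109, -99, -63, 75, 27, -117, -11, 11, 109, 117, -133, -113, -59, 55, 133, 43,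
        -45, -71, -11, -61, 79, -111, -57, -87, 29, 103, 133, 37, -71, -39, -81, -27, 57, 13, -91,
        -127, 35, 117, 91, -115, 79, -63, 19, 99, -143, -81, -13, 113, 35, 47, 143, 99, -101, -29,
        -55, 83, -125, 127, -43, 111, 65, -19, 35, -119, -37, 51, 15, 23, -55, 67, 31, -35, -139,
        115, 13, 47, -131, -111, -75, 61, 125, -15, 139, -35, 49, 87, -89, -13, 63, -57, -23, 39,
        91, 119, 131, 71, -47, -35, 81, -79, 101, -31, 59, -131, -121, -113, 71, 61, 23, -109,
        -135, -123, 31, 81, 57, 111, -51, -109, -133, -79, 45, 131, -47, 149, 135, -65, -117, 63,
        -103, -91, -39, -23, 121, -49, 133, 149, -67, 123, -83, 39, -61, 113, -99, -31, 11, 149,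
        89, -133, 55, 109, -99, -63, 75, 27, -117, -11, 11, 109, 117, -133, -113, -59, 55, 133,
        43, -45, -71, -11, -61, 79, -111, -57, -87, 29, 103, 133, 37, -71, -39, -81, -27, 57, 13,
        -91, -127, 35, 117, 91, -115, 79, -63, 19, 99, -143, -81, -13, 113, 35, 47, 143, 99, -101,
        -29, -55]" _
      "[1, 2, 175, 174, 173, 98, 97, 96, 295, 296, 297, 298]"],
    simp, simp add: expand_simps, simp only: check_simps cong: if_weak_cong)

lemma order_300: "300 \<in> kg_spectrum 3 12"
  by (rule lcf_spectrum[of 50
      "[-45, -27, 111, 45, 27, -111]" _
      "[1, 2, 275, 274, 19, 18, 17, 44, 43, 298, 299, 300]"],
    simp, simp add: expand_simps, simp only: check_simps cong: if_weak_cong)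

lemma order_302: "302 \<in> kg_spectrum 3 12"
  by (rule lcf_spectrum[of 1
      "[-11, 29, -135, -45, 83, -97, 151, -11, 41, -25, 129, 45, 103, -69, 75, -53, 111, 151, 135,
        -27, 73, 125, -37, -113, -143, 101, 51, -59, 71, 81, -29, -139, 143, 51, -79, 59, 151, 41,
        -65, 103, 31, 93, 151, 139, 13, 51, -121, 33, -95, -41, 71, -121, -137, 55, -77, -89, -45,
        -13, 71, 97, 31, 113, 43, 59, 77, -119, 137, -81, 151, 33, 55, -31, -75, -117, -137, 63,
        121, -51, -41, 35, -33, 121, -101, 61, -51, 151, 37, -83, 137, -75, -121, -31, -143, -73,
        -59, 69, -51, 119, 51, -71, 143, -141, -33, 13, 95, -43, 79, 117, -55, 45, -81, 141, 21,
        53, -35, -103, -13, 89, 27, 59, 121, -71, -59, -37, 65, -55, -101, -111, 77, -71, -131,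
        151, 101, -21, -93, 25, 37, 81, -63, -129, 11, -77, -103, 27, -61, -27, -125, 11, 75, -51,
        131, -11, 29, -135, -45, 83, -97, 151, -11, 41, -25, 129, 45, 103, -69, 75, -53, 111, 151,
        135, -27, 73, 125, -37, -113, -143, 101, 51, -59, 71, 81, -29, -139, 143, 51, -79, 59,
        151, 41, -65, 103, 31, 93, 151, 139, 13, 51, -121, 33, -95, -41, 71, -121, -137, 55, -77,
        -89, -45, -13, 71, 97, 31, 113, 43, 59, 77, -119, 137, -81, 151, 33, 55, -31, -75, -117,
        -137, 63, 121, -51, -41, 35, -33, 121, -101, 61, -51, 151, 37, -83, 137, -75, -121, -31,
        -143, -73, -59, 69, -51, 119, 51, -71, 143, -141, -33, 13, 95, -43, 79, 117, -55, 45, -81,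
        141, 21, 53, -35, -103, -13, 89, 27, 59, 121, -71, -59, -37, 65, -55, -101, -111, 77, -71,
        -131, 151, 101, -21, -93, 25, 37, 81, -63, -129, 11, -77, -103, 27, -61, -27, -125, 11,
        75, -51, 131]" _
      "[1, 2, 3, 170, 171, 172, 173, 298, 299, 300, 301, 302]"],
    simp, simp add: expand_simps, simp only: check_simps cong: if_weak_cong)

lemma order_304: "304 \<in> kg_spectrum 3 12"
  by (rule lcf_spectrum[of 38
      "[-49, 137, -137, 73, -73, 33, -33, 49]" _
      "[1, 2, 139, 140, 141, 68, 69, 300, 301, 302, 303, 304]"],
    simp, simp add: expand_simps, simp only: check_simps cong: if_weak_cong)

lemma order_310: "310 \<in> kg_spectrum 3 12"
  by (rule lcf_spectrum[of 31
      "[-53, -69, 69, -115, -99, 99, -27, 53, 115, 27]" _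
      "[1, 2, 3, 4, 5, 216, 215, 116, 115, 114, 309, 310]"],
    simp, simp add: expand_simps, simp only: check_simps cong: if_weak_cong)

lemma order_312: "312 \<in> kg_spectrum 3 12"
  by (rule lcf_spectrum[of 52
      "[-57, 135, -105, 57, -135, 105]" _
      "[1, 2, 137, 136, 193, 192, 191, 56, 55, 310, 311, 312]"],
    simp, simp add: expand_simps, simp only: check_simps cong: if_weak_cong)

lemma order_314: "314 \<in> kg_spectrum 3 12"
  by (rule lcf_spectrum[of 1
      "[-57, 71, 91, 27, -139, -99, 43, -27, -43, 117, 101, 53, -109, -43, 37, -147, 73, -105,
        -35, 101, -47, 157, 139, 83, 21, 147, 71, 123, 93, 51, -27, -149, 33, 121, -81, -49, 97,
        65, 53, 149, 35, -141, 77, 101, 91, -21, 157, 19, -91, -43, 67, -37, -119, -129, 71, 39,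
        -145, 141, -129, -117, 109, 17, -85, 99, -53, -33, -19, -75, 145, 105, -95, -151, -71,
        -91, -119, -35, -129, 151, -17, 157, -51, 129, -131, 55, -89, 43, 129, -143, 19, -73, 119,
        -53, 49, -91, -39, -143, -117, -71, 17, 117, 57, 143, -65, 45, 129, -139, -83, -19, 131,
        143, 81, -101, 119, -123, 91, -17, 15, -67, -119, -77, -101, -93, 43, 139, 31, -71, -117,
        43, -43, 17, 47, -15, 95, -97, 85, -91, 117, 27, -55, 91, 35, -49, 11, 49, -101, 157, -17,
        123, -45, 75, -123, 157, 89, -11, -121, -31, 119, -57, 71, 91, 27, -139, -99, 43, -27,
        -43, 117, 101, 53, -109, -43, 37, -147, 73, -105, -35, 101, -47, 157, 139, 83, 21, 147,
        71, 123, 93, 51, -27, -149, 33, 121, -81, -49, 97, 65, 53, 149, 35, -141, 77, 101, 91,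
        -21, 157, 19, -91, -43, 67, -37, -119, -129, 71, 39, -145, 141, -129, -117, 109, 17, -85,
        99, -53, -33, -19, -75, 145, 105, -95, -151, -71, -91, -119, -35, -129, 151, -17, 157,
        -51, 129, -131, 55, -89, 43, 129, -143, 19, -73, 119, -53, 49, -91, -39, -143, -117, -71,
        17, 117, 57, 143, -65, 45, 129, -139, -83, -19, 131, 143, 81, -101, 119, -123, 91, -17,
        15, -67, -119, -77, -101, -93, 43, 139, 31, -71, -117, 43, -43, 17, 47, -15, 95, -97, 85,
        -91, 117, 27, -55, 91, 35, -49, 11, 49, -101, 157, -17, 123, -45, 75, -123, 157, 89, -11,
        -121, -31, 119]" _
      "[1, 2, 73, 74, 297, 298, 299, 300, 311, 312, 313, 314]"],
    simp, simp add: expand_simps, simp only: check_simps cong: if_weak_cong)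

lemma order_316: "316 \<in> kg_spectrum 3 12"
  by (rule lcf_spectrum[of 2
      "[-43, 29, -105, 79, -29, 43, -129, 145, 105, -13, -31, 21, -69, 77, 107, -89, 137, 61, -19,
        107, -103, -31, 61, -41, 69, 25, -141, 109, 35, -101, -29, -151, -21, -69, 73, 129, -53,
        -137, 151, 37, -67, -49, 57, 141, -79, 11, 99, -133, -43, -127, -25, -147, -83, 55, -101,
        105, -11, 35, 137, -71, -115, -87, 147, -35, -103, 39, -75, 45, -101, -125, 59, 27, 133,
        -111, 17, 103, -37, -125, -61, 37, 127, -139, -79, -61, 89, 57, 101, -131, 17, -153, -77,
        -17, -35, -69, 153, -119, 13, 21, -27, -57, 139, 69, 125, 115, -39, -17, 45, -73, -55,
        -13, 125, 101, -45, -105, 131, 43, -37, 21, -21, 103, 111, -107, 69, 79, -147, 101, -107,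
        83, 15, -59, -149, 67, 87, 29, 119, 147, -109, 31, -21, 149, 41, 53, -57, -15, 11, -99,
        71, -149, 31, 75, 49, -45, -145, -137, 13, -11, 149, 19]" _
      "[1, 2, 31, 32, 33, 12, 11, 10, 313, 314, 315, 316]"],
    simp, simp add: expand_simps, simp only: check_simps cong: if_weak_cong)

lemma order_320: "320 \<in> kg_spectrum 3 12"
  by (rule lcf_spectrum[of 40
      "[-73, 51, 11, 107, -51, -11, -107, 73]" _
      "[1, 2, 3, 4, 5, 6, 315, 316, 317, 318, 319, 320]"],
    simp, simp add: expand_simps, simp only: check_simps cong: if_weak_cong)

lemma order_322: "322 \<in> kg_spectrum 3 12"
  by (rule lcf_spectrum[of 23
      "[-65, 161, 121, -151, -121, 65, 151, -65, 161, 121, -151, -121, 65, 151]" _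
      "[1, 2, 163, 164, 165, 166, 167, 168, 319, 320, 321, 322]"],
    simp, simp add: expand_simps, simp only: check_simps cong: if_weak_cong)

lemma order_326: "326 \<in> kg_spectrum 3 12"
  by (rule lcf_spectrum[of 1
      "[-69, 59, 81, -137, 113, -79, 121, -133, -125, 81, -61, 71, 21, -47, -151, -35, 117, 11,
        -133, 19, 37, -97, 57, 79, 163, -95, 151, -39, -11, 137, 75, 163, -37, -21, 89, 63, -129,
        133, -19, 77, -149, -95, 163, 37, -67, 17, 125, 57, 133, 47, 23, 63, -69, -91, 149, -65,
        35, -37, 97, 71, -59, -103, -17, -123, 85, 73, 91, 11, 51, -71, 129, -95, 13, -23, -117,
        67, -133, 49, -11, -57, -37, 81, -71, -81, 23, -13, 51, 97, -107, 79, -81, -35, -95, 95,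
        69, 33, -47, 51, -63, -121, -109, -153, -79, 123, -57, -75, 133, -23, 39, 95, -137, 153,
        61, 21, -63, -147, -77, -113, -129, -51, 117, 103, 13, -89, 163, 91, -49, -121, -33, 47,
        -71, 147, -139, -117, -21, -13, 137, -51, -73, 95, 67, 121, -67, 35, 107, -149, 69, -39,
        -51, -85, 163, 39, 129, 65, 109, -97, 139, -91, 37, 149, 95, 71, -81, -69, 59, 81, -137,
        113, -79, 121, -133, -125, 81, -61, 71, 21, -47, -151, -35, 117, 11, -133, 19, 37, -97,
        57, 79, 163, -95, 151, -39, -11, 137, 75, 163, -37, -21, 89, 63, -129, 133, -19, 77, -149,
        -95, 163, 37, -67, 17, 125, 57, 133, 47, 23, 63, -69, -91, 149, -65, 35, -37, 97, 71, -59,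
        -103, -17, -123, 85, 73, 91, 11, 51, -71, 129, -95, 13, -23, -117, 67, -133, 49, -11, -57,
        -37, 81, -71, -81, 23, -13, 51, 97, -107, 79, -81, -35, -95, 95, 69, 33, -47, 51, -63,
        -121, -109, -153, -79, 123, -57, -75, 133, -23, 39, 95, -137, 153, 61, 21, -63, -147, -77,
        -113, -129, -51, 117, 103, 13, -89, 163, 91, -49, -121, -33, 47, -71, 147, -139, -117,
        -21, -13, 137, -51, -73, 95, 67, 121, -67, 35, 107, -149, 69, -39, -51, -85, 163, 39, 129,
        65, 109, -97, 139, -91, 37, 149, 95, 71, -81]" _
      "[1, 2, 61, 60, 59, 58, 57, 92, 93, 324, 325, 326]"],
    simp, simp add: expand_simps, simp only: check_simps cong: if_weak_cong)

lemma order_328: "328 \<in> kg_spectrum 3 12"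
  by (rule lcf_spectrum[of 41
      "[-73, -125, 115, 99, 125, -115, -99, 73]" _
      "[1, 2, 3, 118, 119, 120, 121, 122, 325, 326, 327, 328]"],
    simp, simp add: expand_simps, simp only: check_simps cong: if_weak_cong)

section \<open>The spectrum\<close>

lemma even_order_ge_204:
  assumes "even n" "204 \<le> n"
  shows "n \<in> kg_spectrum 3 12"
  using assms
proof (induction n rule: less_induct)
  case (less n)
  have add: "i + j \<in> kg_spectrum 3 12" if "i \<in> kg_spectrum 3 12" "j \<in> kg_spectrum 3 12" for i j
    using kg_spectrum_add that by simp
  show ?case
  proof (cases "n < 330")
    case True
    have sums: "252 \<in> kg_spectrum 3 12" "288 \<in> kg_spectrum 3 12" "294 \<in> kg_spectrum 3 12" "306 \<in> kg_spectrum 3 12" "308 \<in> kg_spectrum 3 12" "318 \<in> kg_spectrum 3 12" "324 \<in> kg_spectrum 3 12"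
      using add[OF order_126 order_126] add[OF order_126 order_162] add[OF order_126 order_168]
        add[OF order_126 order_180] add[OF order_126 order_182] add[OF order_126 order_192]
        add[OF order_162 order_162] by simp_all
    have all: "list_all (\<lambda>j. 2 * j \<in> kg_spectrum 3 12) [102..<165]"
      by (simp add: upt_rec_numeral sums
          order_204 order_206 order_208 order_210 order_212 order_214 order_216 order_218
          order_220 order_222 order_224 order_226 order_228 order_230 order_232 order_234
          order_236 order_238 order_240 order_242 order_244 order_246 order_248 order_250
          order_254 order_256 order_258 order_260 order_262 order_264 order_266 order_268
          order_270 order_272 order_274 order_276 order_278 order_280 order_282 order_284
          order_286 order_290 order_292 order_296 order_298 order_300 order_302 order_304
          order_310 order_312 order_314 order_316 order_320 order_322 order_326 order_328)
    obtain j where j: "n = 2 * j" using less.prems(1) by blast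
    then have "j \<in> {102..<165}" using less.prems(2) True by auto
    from all[unfolded list_all_iff set_upt] this show ?thesis unfolding j by (rule bspec)
  next
    case False
    then have "n - 126 \<in> kg_spectrum 3 12" using less by simp
    then show ?thesis using add[OF order_126, of "n - 126"] False by simp
  qed
qed

theorem mainTheorem7:
  fixes S A U :: "nat set"
  assumes S: "S = kg_spectrum 3 12"
    and A: "A = {126, 162, 168, 180, 182, 192} \<union> {n. even n \<and> n \<ge> 204}"
    and U: "U = {n. even n \<and>
                 n \<in> {128..160} \<union> {164..166} \<union> {170..178} \<union> {184..190} \<union> {194..202}}"
  shows "A \<subseteq> S \<and> S \<subseteq> A \<union> U \<and> kg_N 3 12 \<le> 204"
proof (intro conjI subsetI)
  show "n \<in> S" if "n \<in> A" for n
    using that unfolding A S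
    by (auto simp: order_126 order_162 order_168 order_180 order_182 order_192 even_order_ge_204)
  show "n \<in> A \<union> U" if "n \<in> S" for n
  proof -
    have n: "even n" "126 \<le> n" using spectrum_3_12_bounds that unfolding S by auto
    then obtain j where "n = 2 * j" by blast
    then have "n \<in> {126, 162, 168, 180, 182, 192} \<or> n \<ge> 204 \<or>
        n \<in> {128..160} \<union> {164..166} \<union> {170..178} \<union> {184..190} \<union> {194..202}"
      using n(2) by (simp; presburger)
    then show ?thesis using n(1) unfolding A U by blast
  qed
  show "kg_N 3 12 \<le> 204"
    unfolding kg_N_def by (rule Least_le) (simp add: even_order_ge_204)
qed

end
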